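(* Let $\kappa$ be an algebraically closed field of characteristic zero, complete for a non-trivial non-Archimedean absolute value. Fix a positive integer $n$ and $\alpha_i,\beta_i\in\kappa$ ($i=0,\dots,n$) with $|\alpha_i|=1$, $\alpha_0=1$, $\beta_0=0$, such that the maps $L_i(z)=\alpha_iz+\beta_i$ are pairwise distinct. Let $\Omega(X_0,\dots,X_n)=\sum_{i\in I}c_iX_0^{i_0}\cdots X_n^{i_n}$ be a non-zero polynomial with coefficients $c_i\in\mathcal{M}(\kappa)$. Let $f\in\mathcal{M}(\kappa)$ be non-constant, put $f_i=f\circ L_i$, and suppose $$\Omega(f,f_1,\dots,f_n)=0$$ with $f$ admissible, i.e. $\sum_{i\in I}T(r,c_i)=o(T(r,f))$ as $r\to\infty$. If $a\in\mathcal{M}(\kappa)$ satisfies $T(r,a)=o(T(r,f))$ and $\Omega(a,a\circ L_1,\dots,a\circ L_n)\not\equiv0$, then $$m\!\left(r,\frac1{f-a}\right)=o(T(r,f))\quad(r\to\infty).$$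
   Context: $\mathcal{M}(\kappa)$ is the field of meromorphic functions over $\kappa$ (quotients of power series converging on all of $\kappa$). For entire $g=\sum a_nz^n$, $\mu(r,g)=\max_n|a_n|r^n$, and for $f=g/h$, $\mu(r,f)=\mu(r,g)/\mu(r,h)$; $m(r,f)=\log^+\mu(r,f)$; $N(r,f)=\int_0^r\frac{n(t,f)-n(0,f)}{t}dt+n(0,f)\log r$ where $n(t,f)$ counts poles in $|z|\le t$ with multiplicity; $T(r,f)=m(r,f)+N(r,f)$. *)

theory Defs
  imports "HOL-Analysis.Analysis" "HOL-Computational_Algebra.Polynomial" "HOL-Library.Landau_Symbols"
begin

definition nonarch_abs :: "('k::field \<Rightarrow> real) \<Rightarrow> bool" where
  "nonarch_abs absv \<longleftrightarrow>
     (\<forall>x. absv x \<ge> 0) \<and> (\<forall>x. absv x = 0 \<longleftrightarrow> x = 0) \<and>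
     (\<forall>x y. absv (x * y) = absv x * absv y) \<and>
     (\<forall>x y. absv (x + y) \<le> max (absv x) (absv y))"

definition nontrivial_abs :: "('k::field \<Rightarrow> real) \<Rightarrow> bool" where
  "nontrivial_abs absv \<longleftrightarrow> (\<exists>x. absv x \<noteq> 0 \<and> absv x \<noteq> 1)"

definition complete_abs :: "('k::field \<Rightarrow> real) \<Rightarrow> bool" where
  "complete_abs absv \<longleftrightarrow>
     (\<forall>s::nat \<Rightarrow> 'k. (\<forall>e>0. \<exists>N. \<forall>m\<ge>N. \<forall>k\<ge>N. absv (s m - s k) < e) \<longrightarrow>
        (\<exists>L. (\<lambda>k. absv (s k - L)) \<longlonglongrightarrow> 0))"

definition is_entire_ps :: "('k::field \<Rightarrow> real) \<Rightarrow> (nat \<Rightarrow> 'k) \<Rightarrow> bool" where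
  "is_entire_ps absv a \<longleftrightarrow> (\<forall>z. (\<lambda>k. absv (a k) * absv z ^ k) \<longlonglongrightarrow> 0)"

definition ps_eval :: "('k::field \<Rightarrow> real) \<Rightarrow> (nat \<Rightarrow> 'k) \<Rightarrow> 'k \<Rightarrow> 'k" where
  "ps_eval absv a z = (THE L. (\<lambda>N. absv ((\<Sum>k<N. a k * z ^ k) - L)) \<longlonglongrightarrow> 0)"

definition entire_fun :: "('k::field \<Rightarrow> real) \<Rightarrow> ('k \<Rightarrow> 'k) \<Rightarrow> bool" where
  "entire_fun absv G \<longleftrightarrow> (\<exists>a. is_entire_ps absv a \<and> G = ps_eval absv a)"

definition ps_coeffs :: "('k::field \<Rightarrow> real) \<Rightarrow> ('k \<Rightarrow> 'k) \<Rightarrow> nat \<Rightarrow> 'k" where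
  "ps_coeffs absv G = (SOME a. is_entire_ps absv a \<and> G = ps_eval absv a)"

text \<open>\<open>\<mu>(r,g) = max_n |a_n| r^n\<close> (the maximum is attained; we write it as a supremum).\<close>
definition mu_ent :: "('k::field \<Rightarrow> real) \<Rightarrow> real \<Rightarrow> ('k \<Rightarrow> 'k) \<Rightarrow> real" where
  "mu_ent absv r G = (SUP k. absv (ps_coeffs absv G k) * r ^ k)"

text \<open>Meromorphic functions are represented by total functions; their values are only
  relevant off a ``thin'' set, i.e. a set meeting every closed disk in finitely many points.
  Identity of meromorphic functions is equality off such a set.\<close>

definition ae_eq :: "('k::field \<Rightarrow> real) \<Rightarrow> ('k \<Rightarrow> 'k) \<Rightarrow> ('k \<Rightarrow> 'k) \<Rightarrow> bool" where
  "ae_eq absv f g \<longleftrightarrow> (\<forall>r. finite {z. absv z \<le> r \<and> f z \<noteq> g z})"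

definition merom_rep :: "('k::field \<Rightarrow> real) \<Rightarrow> ('k \<Rightarrow> 'k) \<Rightarrow> ('k \<Rightarrow> 'k) \<Rightarrow> ('k \<Rightarrow> 'k) \<Rightarrow> bool" where
  "merom_rep absv f G H \<longleftrightarrow> entire_fun absv G \<and> entire_fun absv H \<and> H \<noteq> (\<lambda>_. 0) \<and>
     ae_eq absv f (\<lambda>z. G z / H z)"

definition meromorphic :: "('k::field \<Rightarrow> real) \<Rightarrow> ('k \<Rightarrow> 'k) \<Rightarrow> bool" where
  "meromorphic absv f \<longleftrightarrow> (\<exists>G H. merom_rep absv f G H)"

definition mu_merom :: "('k::field \<Rightarrow> real) \<Rightarrow> real \<Rightarrow> ('k \<Rightarrow> 'k) \<Rightarrow> real" where
  "mu_merom absv r f =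
     (SOME m. \<exists>G H. merom_rep absv f G H \<and> m = mu_ent absv r G / mu_ent absv r H)"

definition zero_order :: "('k::field \<Rightarrow> real) \<Rightarrow> ('k \<Rightarrow> 'k) \<Rightarrow> 'k \<Rightarrow> nat" where
  "zero_order absv H z0 =
     (GREATEST k. \<exists>K. entire_fun absv K \<and> (\<forall>z. H z = (z - z0) ^ k * K z))"

definition pole_order :: "('k::field \<Rightarrow> real) \<Rightarrow> ('k \<Rightarrow> 'k) \<Rightarrow> 'k \<Rightarrow> nat" where
  "pole_order absv f z0 = (LEAST k. \<exists>G H. merom_rep absv f G H \<and> zero_order absv H z0 = k)"

definition npoles :: "('k::field \<Rightarrow> real) \<Rightarrow> real \<Rightarrow> ('k \<Rightarrow> 'k) \<Rightarrow> real" where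
  "npoles absv t f = real (\<Sum>z\<in>{z. absv z \<le> t \<and> 0 < pole_order absv f z}. pole_order absv f z)"

definition prox_m :: "('k::field \<Rightarrow> real) \<Rightarrow> real \<Rightarrow> ('k \<Rightarrow> 'k) \<Rightarrow> real" where
  "prox_m absv r f = max 0 (ln (mu_merom absv r f))"

definition count_N :: "('k::field \<Rightarrow> real) \<Rightarrow> real \<Rightarrow> ('k \<Rightarrow> 'k) \<Rightarrow> real" where
  "count_N absv r f =
     integral {0..r} (\<lambda>t. (npoles absv t f - npoles absv 0 f) / t) + npoles absv 0 f * ln r"

definition char_T :: "('k::field \<Rightarrow> real) \<Rightarrow> real \<Rightarrow> ('k \<Rightarrow> 'k) \<Rightarrow> real" where
  "char_T absv r f = prox_m absv r f + count_N absv r f"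

text \<open>A multi-index is a function \<open>nat \<Rightarrow> nat\<close> supported in \<open>{0..n}\<close>;
  \<open>Omega_eval c I n X\<close> is \<open>\<Sum>i\<in>I. c_i X_0^{i_0}\<cdots>X_n^{i_n}\<close> evaluated pointwise.\<close>
definition Omega_eval ::
  "((nat \<Rightarrow> nat) \<Rightarrow> 'k \<Rightarrow> 'k::field) \<Rightarrow> (nat \<Rightarrow> nat) set \<Rightarrow> nat \<Rightarrow> (nat \<Rightarrow> 'k \<Rightarrow> 'k) \<Rightarrow> 'k \<Rightarrow> 'k" where
  "Omega_eval c I n X = (\<lambda>z. \<Sum>i\<in>I. c i z * (\<Prod>j\<le>n. X j z ^ i j))"

end

theory Submission
  imports Defs "HOL-Computational_Algebra.Polynomial_FPS" "HOL-Library.Multiset"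
begin

text \<open>
  Put \<open>h = f - a\<close>. The Gauss norm \<open>\<mu>(r, _)\<close> is multiplicative and ultrametric, and for \<open>r \<ge> |\<beta>\<^sub>j|\<close> it
  is invariant under composition with \<open>L\<^sub>j\<close>. If \<open>\<mu>(r, h) < 1\<close>, then telescoping the differences of
  the monomials in \<open>\<Omega>(a, \<dots>) = \<Omega>(a, \<dots>) - \<Omega>(f, \<dots>)\<close> bounds \<open>\<mu>(r, \<Omega>(a, \<dots>))\<close> by \<open>\<mu>(r, h)\<close> times a factor
  whose logarithm is at most a multiple of the proximity functions of \<open>a\<close> and the \<open>c\<^sub>i\<close>. Conversely
  \<open>\<mu>(r, \<Omega>(a, \<dots>))\<close> cannot be small: by Jensen's formula every meromorphic \<open>g\<close> has a
  normalised denominator of Gauss norm \<open>exp (N(r, g))\<close>, and the Gauss norm of a numerator increases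
  with \<open>r\<close>. Hence \<open>- log \<mu>(r, h)\<close> is at most a multiple of \<open>T(r, a) + \<Sum>\<^sub>i T(r, c\<^sub>i)\<close> up to a constant,
  and constants are negligible because \<open>T(r, f) \<ge> log r - O(1)\<close>.
  Jensen's formula rests on the fact that a power series whose last dominant term at radius \<open>r\<close> has
  positive index has a zero in the disk: nearest roots of successive truncations form a Cauchy sequence.
\<close>

section \<open>Non-Archimedean fields\<close>

text \<open>The definitions pick coefficient sequences and quotients by \<open>SOME\<close> and
  compare functions only off thin sets. Everything is therefore moved to pairs of power series
  through \<open>rep\<close>: finiteness of zeros in disks yields an identity theorem, which makes
  coefficients unique and forces any two representations of a function to agree after
  cross-multiplication. Estimates of N for sums and products are bypassed. Fractions are multiplied
  out, and of a denominator one remembers only that its Gauss norm is at least 1 at a fixed radius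
  \<open>s\<close> and at most a known bound at \<open>r\<close>. The two halves of the argument
  then match: the upper bound for \<Omega>(a, ...) at \<open>r\<close> costs proximity terms, the
  passage from \<open>r\<close> down to \<open>s\<close> costs counting terms with the same
  coefficients, and together they are characteristic functions. What is left over is the Gauss norm
  of \<Omega>(a, ...) at \<open>s\<close>, which does not depend on \<open>r\<close>.\<close>

locale nonarch_field =
  fixes absv :: "'k::field_char_0 \<Rightarrow> real"
  assumes nonarch: "nonarch_abs absv"
    and nontrivial: "nontrivial_abs absv"
    and complete: "complete_abs absv"
    and alg_closed: "\<And>p :: 'k poly. degree p > 0 \<Longrightarrow> \<exists>z. poly p z = 0"
begin

lemma absv_nonneg [simp]: "0 \<le> absv x"
  and absv_eq_0_iff [simp]: "absv x = 0 \<longleftrightarrow> x = 0"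
  and absv_mult [simp]: "absv (x * y) = absv x * absv y"
  and absv_add_le: "absv (x + y) \<le> max (absv x) (absv y)"
  using nonarch by (simp_all add: nonarch_abs_def)

lemma absv_0 [simp]: "absv 0 = 0"
  by simp

lemma absv_pos_iff [simp]: "0 < absv x \<longleftrightarrow> x \<noteq> 0"
  by (metis absv_eq_0_iff absv_nonneg less_eq_real_def less_irrefl)

lemma absv_le_0_iff [simp]: "absv x \<le> 0 \<longleftrightarrow> x = 0"
  by (metis absv_pos_iff not_le)

lemma absv_1 [simp]: "absv 1 = 1"
  using absv_mult[of 1 1] by simp

lemma absv_minus [simp]: "absv (- x) = absv x"
proof -
  have "absv (-1) * absv (-1) = 1"
    using absv_mult[of "-1" "-1"] by simp
  then have "absv (-1) = 1"
    by (metis absv_nonneg abs_of_nonneg power2_eq_square power2_eq_1_iff abs_minus_cancel abs_one)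
  then show ?thesis
    using absv_mult[of "-1" x] by simp
qed

lemma absv_minus_commute: "absv (x - y) = absv (y - x)"
  by (metis absv_minus minus_diff_eq)

lemma absv_diff_le: "absv (x - y) \<le> max (absv x) (absv y)"
  using absv_add_le[of x "- y"] by simp

lemma absv_power [simp]: "absv (x ^ k) = absv x ^ k"
  by (induction k) auto

lemma absv_inverse [simp]: "absv (inverse x) = inverse (absv x)"
proof (cases "x = 0")
  case False
  then have "absv x * absv (inverse x) = 1"
    by (metis absv_1 absv_mult right_inverse)
  then show ?thesis
    by (metis inverse_unique)
qed simp

lemma absv_divide [simp]: "absv (x / y) = absv x / absv y"
  by (simp add: field_class.field_divide_inverse)

lemma absv_sum_le:
  assumes "\<And>i. i \<in> A \<Longrightarrow> absv (f i) \<le> B" "0 \<le> B"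
  shows "absv (sum f A) \<le> B"
  using assms
proof (induction A rule: infinite_finite_induct)
  case (insert x F)
  then show ?case
    using absv_add_le[of "f x" "sum f F"] by fastforce
qed auto

lemma absv_sum_less:
  assumes "\<And>i. i \<in> A \<Longrightarrow> absv (f i) < B" "0 < B"
  shows "absv (sum f A) < B"
  using assms
proof (induction A rule: infinite_finite_induct)
  case (insert x F)
  then show ?case
    using absv_add_le[of "f x" "sum f F"] by fastforce
qed auto

lemma absv_of_nat_le_1: "absv (of_nat k) \<le> 1"
  using absv_sum_le[of "{..<k}" "\<lambda>_. 1" 1] by simp

text \<open>Isosceles principle: writing y as (x + y) - x and using the ultrametric inequality once
  more excludes cancellation.\<close>

lemma absv_add_eq:
  assumes "absv x < absv y"
  shows "absv (x + y) = absv y"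
proof -
  have "absv y \<le> max (absv (x + y)) (absv x)"
    using absv_diff_le[of "x + y" x] by simp
  then show ?thesis
    using absv_add_le[of x y] assms by auto
qed

text \<open>Powers of an element of absolute value above 1 are unbounded. This transfers convergence
  at points of the field to arbitrary real radii.\<close>

lemma ex_absv_ge: "\<exists>z. R \<le> absv z"
proof -
  obtain x where x: "absv x \<noteq> 0" "absv x \<noteq> 1"
    using nontrivial by (auto simp: nontrivial_abs_def)
  obtain y where y: "absv y > 1"
  proof (cases "absv x > 1")
    case False
    then have "absv (inverse x) > 1"
      using x by (simp add: one_less_inverse_iff)
    then show ?thesis using that by blast
  qed (use that in blast)
  obtain k where "R < absv y ^ k"
    using real_arch_pow[OF y] by blast
  then show ?thesis
    by (intro exI[of _ "y ^ k"]) simp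
qed

text \<open>In characteristic zero the natural numbers are distinct points of the unit disk. This is
  why agreement off a thin set carries information.\<close>

lemma infinite_unit_disk: "infinite {z. absv z \<le> 1}"
proof -
  have "infinite (range (of_nat :: nat \<Rightarrow> 'k))"
    by (rule range_inj_infinite) simp
  moreover have "range of_nat \<subseteq> {z. absv z \<le> 1}"
    using absv_of_nat_le_1 by auto
  ultimately show ?thesis
    using finite_subset by blast
qed

section \<open>Limits and convergent series in the field\<close>

definition nlim :: "(nat \<Rightarrow> 'k) \<Rightarrow> 'k \<Rightarrow> bool" where
  "nlim s L \<longleftrightarrow> (\<lambda>k. absv (s k - L)) \<longlonglongrightarrow> 0"

lemma nlimI_le:
  assumes "\<And>k. absv (s k - L) \<le> e k" "e \<longlonglongrightarrow> 0"
  shows "nlim s L"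
  unfolding nlim_def
  by (rule tendsto_sandwich[OF _ _ tendsto_const assms(2)]) (simp_all add: assms)

lemma nlim_add:
  assumes "nlim s L" "nlim t M"
  shows "nlim (\<lambda>k. s k + t k) (L + M)"
proof (rule nlimI_le)
  show "absv (s k + t k - (L + M)) \<le> max (absv (s k - L)) (absv (t k - M))" for k
    using absv_add_le[of "s k - L" "t k - M"] by (simp add: algebra_simps)
  show "(\<lambda>k. max (absv (s k - L)) (absv (t k - M))) \<longlonglongrightarrow> 0"
    using tendsto_max[OF assms[unfolded nlim_def]] by simp
qed

lemma nlim_cmult:
  assumes "nlim s L"
  shows "nlim (\<lambda>k. c * s k) (c * L)"
  using tendsto_mult_left[OF assms[unfolded nlim_def], of "absv c"]
  by (simp add: nlim_def flip: absv_mult right_diff_distrib)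

lemma nlim_const: "nlim (\<lambda>_. c) c"
  by (simp add: nlim_def)

lemma nlim_absv_le:
  assumes "nlim s L" "\<And>k. absv (s k) \<le> B"
  shows "absv L \<le> B"
proof (rule ccontr)
  assume *: "\<not> absv L \<le> B"
  have "0 \<le> B"
    using assms(2)[of 0] absv_nonneg order_trans by blast
  then have "\<forall>\<^sub>F k in sequentially. absv (s k - L) < absv L"
    using assms(1) * unfolding nlim_def by (intro order_tendstoD(2)) auto
  then obtain k where "absv (s k - L) < absv L"
    by (auto simp: eventually_sequentially)
  then have "absv (s k) = absv L"
    using absv_add_eq[of "s k - L" L] by simp
  then show False
    using assms(2)[of k] * by simp
qed

lemma nlim_unique:
  assumes "nlim s L" "nlim s M"
  shows "L = M"
proof -
  have "nlim (\<lambda>k. s k + -1 * s k) (L + -1 * M)"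
    by (intro nlim_add nlim_cmult assms)
  then have "absv (L + -1 * M) \<le> 0"
    by (rule nlim_absv_le) simp
  then show ?thesis
    by simp
qed

lemma nlim_Suc_iff: "nlim (\<lambda>k. s (Suc k)) L \<longleftrightarrow> nlim s L"
  unfolding nlim_def by (rule filterlim_sequentially_Suc)

text \<open>By the ultrametric inequality a difference of two members is at most the largest
  consecutive difference between them, so the sequence is Cauchy. In particular a series converges
  as soon as its terms tend to 0.\<close>

lemma nlim_ex:
  assumes "(\<lambda>k. absv (s (Suc k) - s k)) \<longlonglongrightarrow> 0"
  shows "\<exists>L. nlim s L"
proof -
  have "\<exists>N. \<forall>m\<ge>N. \<forall>k\<ge>N. absv (s m - s k) < e" if e: "e > 0" for e
  proof -
    obtain N where N: "\<And>k. k \<ge> N \<Longrightarrow> absv (s (Suc k) - s k) < e"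
      using order_tendstoD(2)[OF assms e] by (auto simp: eventually_sequentially)
    have *: "absv (s m - s N) < e" if "m \<ge> N" for m
      using that
    proof (induction m rule: dec_induct)
      case (step m)
      then show ?case
        using absv_add_le[of "s (Suc m) - s m" "s m - s N"] N[of m] by simp
    qed (use e in simp)
    have "absv (s m - s k) < e" if "m \<ge> N" "k \<ge> N" for m k
      using absv_diff_le[of "s m - s N" "s k - s N"] *[OF that(1)] *[OF that(2)] by simp
    then show ?thesis by blast
  qed
  then show ?thesis
    using complete unfolding complete_abs_def nlim_def by blast
qed

lemma ps_eval_eqI:
  assumes "nlim (\<lambda>N. \<Sum>k<N. a k * z ^ k) L"
  shows "ps_eval absv a z = L"
  unfolding ps_eval_def nlim_def[symmetric]
  using assms nlim_unique by (intro the_equality) blast+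

lemma nlim_ps_eval:
  assumes "(\<lambda>k. absv (a k) * absv z ^ k) \<longlonglongrightarrow> 0"
  shows "nlim (\<lambda>N. \<Sum>k<N. a k * z ^ k) (ps_eval absv a z)"
proof -
  obtain L where "nlim (\<lambda>N. \<Sum>k<N. a k * z ^ k) L"
    using nlim_ex[of "\<lambda>N. \<Sum>k<N. a k * z ^ k"] assms by auto
  then show ?thesis
    using ps_eval_eqI by simp
qed

lemma absv_ps_eval_le:
  assumes "(\<lambda>k. absv (a k) * absv z ^ k) \<longlonglongrightarrow> 0" "\<And>k. absv (a k) * absv z ^ k \<le> B"
  shows "absv (ps_eval absv a z) \<le> B"
proof (rule nlim_absv_le[OF nlim_ps_eval[OF assms(1)]])
  fix N
  have "0 \<le> B"
    using assms(2)[of 0] by (smt (verit) absv_nonneg mult_nonneg_nonneg zero_le_power)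
  then show "absv (\<Sum>k<N. a k * z ^ k) \<le> B"
    using assms(2) by (intro absv_sum_le) auto
qed

section \<open>Entire power series and the Gauss norm\<close>

text \<open>Real radii are used instead of points because Gauss norms are taken at every real
  radius, while the value group may omit some reals.\<close>

definition ent :: "'k fps \<Rightarrow> bool" where
  "ent g \<longleftrightarrow> (\<forall>R\<ge>0. (\<lambda>k. absv (fps_nth g k) * R ^ k) \<longlonglongrightarrow> 0)"

definition ev :: "'k fps \<Rightarrow> 'k \<Rightarrow> 'k" where
  "ev g = ps_eval absv (fps_nth g)"

definition gnorm :: "real \<Rightarrow> 'k fps \<Rightarrow> real" where
  "gnorm R g = (SUP k. absv (fps_nth g k) * R ^ k)"

text \<open>The vertex of the Newton polygon at this radius. Choosing the last maximal term makes
  the index count the zeros in the closed disk, with multiplicity.\<close>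

definition dom_index :: "real \<Rightarrow> 'k fps \<Rightarrow> nat \<Rightarrow> bool" where
  "dom_index R g N \<longleftrightarrow> absv (fps_nth g N) * R ^ N = gnorm R g \<and>
     (\<forall>k>N. absv (fps_nth g k) * R ^ k < gnorm R g)"

lemma entI:
  assumes "\<And>R. R \<ge> B \<Longrightarrow> R \<ge> 1 \<Longrightarrow> (\<lambda>k. absv (fps_nth g k) * R ^ k) \<longlonglongrightarrow> 0"
  shows "ent g"
  unfolding ent_def
proof safe
  fix R :: real assume R: "R \<ge> 0"
  have *: "(\<lambda>k. absv (fps_nth g k) * max R (max B 1) ^ k) \<longlonglongrightarrow> 0"
    by (intro assms) auto
  show "(\<lambda>k. absv (fps_nth g k) * R ^ k) \<longlonglongrightarrow> 0"
    using R by (intro tendsto_sandwich[OF _ _ tendsto_const *])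
      (auto intro!: always_eventually mult_left_mono power_mono)
qed

lemma is_entire_ps_iff: "is_entire_ps absv (fps_nth g) \<longleftrightarrow> ent g"
proof
  assume *: "is_entire_ps absv (fps_nth g)"
  show "ent g"
    unfolding ent_def
  proof safe
    fix R :: real assume R: "R \<ge> 0"
    obtain z where z: "R \<le> absv z" using ex_absv_ge by blast
    have **: "(\<lambda>k. absv (fps_nth g k) * absv z ^ k) \<longlonglongrightarrow> 0"
      using * by (simp add: is_entire_ps_def)
    show "(\<lambda>k. absv (fps_nth g k) * R ^ k) \<longlonglongrightarrow> 0"
      using R z by (intro tendsto_sandwich[OF _ _ tendsto_const **])
        (auto intro!: always_eventually mult_left_mono power_mono)
  qed
qed (simp add: is_entire_ps_def ent_def)

lemma entD: "ent g \<Longrightarrow> 0 \<le> R \<Longrightarrow> (\<lambda>k. absv (fps_nth g k) * R ^ k) \<longlonglongrightarrow> 0"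
  by (simp add: ent_def)

lemma gnorm_ge:
  assumes "ent g" "0 \<le> R"
  shows "absv (fps_nth g k) * R ^ k \<le> gnorm R g"
proof -
  have "Bseq (\<lambda>k. absv (fps_nth g k) * R ^ k)"
    using entD[OF assms] convergentI convergent_imp_Bseq by blast
  then have "bdd_above (range (\<lambda>k. absv (fps_nth g k) * R ^ k))"
    by (rule Bseq_bdd_above)
  then show ?thesis
    unfolding gnorm_def by (rule cSUP_upper[rotated]) simp
qed

lemma gnorm_le:
  assumes "\<And>k. absv (fps_nth g k) * R ^ k \<le> B"
  shows "gnorm R g \<le> B"
  unfolding gnorm_def using assms by (intro cSUP_least) auto

lemma gnorm_eqI:
  assumes "\<And>k. absv (fps_nth g k) * R ^ k \<le> B" "absv (fps_nth g N) * R ^ N = B"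
  shows "gnorm R g = B"
  unfolding gnorm_def using assms by (intro cSup_eq_maximum) auto

lemma gnorm_nonneg: "ent g \<Longrightarrow> 0 \<le> R \<Longrightarrow> 0 \<le> gnorm R g"
  using gnorm_ge[of g R 0] by (smt (verit) absv_nonneg mult_nonneg_nonneg zero_le_power)

lemma gnorm_0 [simp]: "gnorm R 0 = 0"
  by (simp add: gnorm_def)

lemma gnorm_pos:
  assumes "ent g" "0 < R" "g \<noteq> 0"
  shows "0 < gnorm R g"
proof -
  obtain k where "fps_nth g k \<noteq> 0"
    using assms(3) by (auto simp: fps_eq_iff)
  then have "0 < absv (fps_nth g k) * R ^ k"
    using assms(2) by simp
  also have "\<dots> \<le> gnorm R g"
    using assms by (intro gnorm_ge) auto
  finally show ?thesis .
qed

lemma gnorm_mono: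
  assumes "ent g" "0 \<le> R" "R \<le> S"
  shows "gnorm R g \<le> gnorm S g"
proof (rule gnorm_le)
  fix k
  have "absv (fps_nth g k) * R ^ k \<le> absv (fps_nth g k) * S ^ k"
    using assms by (intro mult_left_mono power_mono) auto
  also have "\<dots> \<le> gnorm S g"
    using assms by (intro gnorm_ge) auto
  finally show "absv (fps_nth g k) * R ^ k \<le> gnorm S g" .
qed

section \<open>Sums and products in the Gauss norm\<close>

lemma ent_add:
  assumes "ent g" "ent h"
  shows "ent (g + h)"
  unfolding ent_def
proof safe
  fix R :: real assume R: "R \<ge> 0"
  have *: "(\<lambda>k. absv (fps_nth g k) * R ^ k + absv (fps_nth h k) * R ^ k) \<longlonglongrightarrow> 0"
    using tendsto_add[OF entD[OF assms(1) R] entD[OF assms(2) R]] by simp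
  have **: "absv (fps_nth (g + h) k) \<le> absv (fps_nth g k) + absv (fps_nth h k)" for k
    using absv_add_le[of "fps_nth g k" "fps_nth h k"] 
    by (smt (verit) absv_nonneg fps_add_nth)
  show "(\<lambda>k. absv (fps_nth (g + h) k) * R ^ k) \<longlonglongrightarrow> 0"
    using R ** by (intro tendsto_sandwich[OF _ _ tendsto_const *])
      (auto intro!: always_eventually mult_right_mono simp flip: distrib_right)
qed

lemma gnorm_add_le:
  assumes "ent g" "ent h" "0 \<le> R"
  shows "gnorm R (g + h) \<le> max (gnorm R g) (gnorm R h)"
proof (rule gnorm_le)
  fix k
  have "absv (fps_nth (g + h) k) * R ^ k \<le> max (absv (fps_nth g k)) (absv (fps_nth h k)) * R ^ k"
    using absv_add_le assms by (auto intro!: mult_right_mono)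
  also have "\<dots> = max (absv (fps_nth g k) * R ^ k) (absv (fps_nth h k) * R ^ k)"
    using assms by (simp add: max_mult_distrib_right)
  also have "\<dots> \<le> max (gnorm R g) (gnorm R h)"
    using assms by (intro max.mono gnorm_ge)
  finally show "absv (fps_nth (g + h) k) * R ^ k \<le> max (gnorm R g) (gnorm R h)" .
qed

lemma absv_mult_nth_le:
  assumes "\<And>i j. i + j = k \<Longrightarrow> (absv (fps_nth g i) * R ^ i) * (absv (fps_nth h j) * R ^ j) \<le> B"
    and "0 \<le> B" "0 < R"
  shows "absv (fps_nth (g * h) k) * R ^ k \<le> B"
proof -
  have "absv (fps_nth (g * h) k) \<le> B / R ^ k"
    unfolding fps_mult_nth
  proof (rule absv_sum_le)
    fix i assume "i \<in> {0..k}"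
    then have "R ^ k = R ^ i * R ^ (k - i)" and "i + (k - i) = k"
      by (simp_all flip: power_add)
    then show "absv (fps_nth g i * fps_nth h (k - i)) \<le> B / R ^ k"
      using assms(1)[of i "k - i"] assms(3) by (simp add: field_simps)
  qed (use assms in auto)
  then show ?thesis
    using assms(3) by (simp add: field_simps)
qed

text \<open>Boundedness at radius 2R gives geometric decay, with ratio 1/2, at radius R.\<close>

lemma entI_bounded:
  assumes "\<And>R. R \<ge> B \<Longrightarrow> R \<ge> 1 \<Longrightarrow> \<exists>C. \<forall>k. absv (fps_nth g k) * R ^ k \<le> C"
  shows "ent g"
proof (rule entI[of B])
  fix R :: real assume R: "R \<ge> B" "R \<ge> 1"
  obtain C where C: "\<And>k. absv (fps_nth g k) * (2 * R) ^ k \<le> C"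
    using assms[of "2 * R"] R by auto
  have *: "(\<lambda>k. C * (1 / 2) ^ k) \<longlonglongrightarrow> 0"
    using tendsto_mult_right_zero[OF LIMSEQ_power_zero[of "1 / 2 :: real"], of C] by simp
  show "(\<lambda>k. absv (fps_nth g k) * R ^ k) \<longlonglongrightarrow> 0"
  proof (rule tendsto_sandwich[OF _ _ tendsto_const *])
    show "\<forall>\<^sub>F k in sequentially. absv (fps_nth g k) * R ^ k \<le> C * (1 / 2) ^ k"
      using C by (intro always_eventually) (simp add: power_mult_distrib power_divide field_simps)
  qed (use R in auto)
qed

lemma ent_mult:
  assumes "ent g" "ent h"
  shows "ent (g * h)"
proof (rule entI_bounded)
  fix R :: real assume R: "R \<ge> 1"
  have "absv (fps_nth (g * h) k) * R ^ k \<le> gnorm R g * gnorm R h" for k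
    using assms R by (intro absv_mult_nth_le mult_mono gnorm_ge gnorm_nonneg mult_nonneg_nonneg) auto
  then show "\<exists>C. \<forall>k. absv (fps_nth (g * h) k) * R ^ k \<le> C" by blast
qed

text \<open>The terms tend to 0, so some nonzero term beats all terms beyond a finite initial
  segment. The supremum is thus attained, and at finitely many indices.\<close>

lemma ex_dom_index:
  assumes "ent g" "g \<noteq> 0" "0 < R"
  shows "\<exists>N. dom_index R g N"
proof -
  let ?t = "\<lambda>k. absv (fps_nth g k) * R ^ k"
  obtain k0 where k0: "?t k0 > 0"
    using assms by (metis absv_pos_iff fps_nonzero_nth mult_pos_pos zero_less_power)
  obtain n0 where n0: "\<And>k. k \<ge> n0 \<Longrightarrow> ?t k < ?t k0"
    using order_tendstoD(2)[OF entD[OF assms(1), of R] k0] assms(3)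
    by (auto simp: eventually_sequentially)
  define m where "m = Max (?t ` {..n0 + k0})"
  have m_ge: "?t k \<le> m" if "k \<le> n0 + k0" for k
    unfolding m_def using that by (intro Max_ge) auto
  have le: "?t k \<le> m" for k
    using m_ge[of k] m_ge[of k0] n0[of k] by (cases "k \<le> n0 + k0") auto
  have "m \<in> ?t ` {..n0 + k0}"
    unfolding m_def by (intro Max_in) auto
  then obtain k1 where k1: "?t k1 = m" by auto
  have gm: "gnorm R g = m"
    using le k1 by (rule gnorm_eqI)
  have fin: "finite {k. ?t k = m}"
  proof (rule finite_subset)
    show "{k. ?t k = m} \<subseteq> {..n0 + k0}"
    proof
      fix k assume "k \<in> {k. ?t k = m}"
      then show "k \<in> {..n0 + k0}"
        using n0[of k] m_ge[of k0] by (cases "k \<le> n0 + k0") auto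
    qed
  qed simp
  define N where "N = Max {k. ?t k = m}"
  have "N \<in> {k. ?t k = m}"
    unfolding N_def using fin k1 by (intro Max_in) auto
  moreover have "?t k < m" if "k > N" for k
  proof -
    have "k \<notin> {k. ?t k = m}"
      using Max_ge[OF fin, of k] that by (auto simp: N_def)
    then show ?thesis using le[of k] by auto
  qed
  ultimately show ?thesis
    unfolding dom_index_def gm by auto
qed

lemma dom_index_unique: "dom_index R g N \<Longrightarrow> dom_index R g M \<Longrightarrow> N = M"
  unfolding dom_index_def by (metis less_irrefl nat_neq_iff)

text \<open>Gauss's lemma: if i + j = N + M and (i, j) differs from (N, M), then i > N or j > M, so
  the product of the two dominant terms strictly exceeds every other summand of that coefficient and
  cannot be cancelled.\<close>

lemma dom_index_mult_aux:
  assumes "ent g" "ent h" "0 < R" "g \<noteq> 0" "h \<noteq> 0" "dom_index R g N" "dom_index R h M"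
  shows "gnorm R (g * h) = gnorm R g * gnorm R h \<and> dom_index R (g * h) (N + M)"
proof -
  let ?s = "\<lambda>k. absv (fps_nth g k) * R ^ k" and ?t = "\<lambda>k. absv (fps_nth h k) * R ^ k"
  have pos: "gnorm R g > 0" "gnorm R h > 0"
    using assms by (auto intro: gnorm_pos)
  have ge: "?s k \<le> gnorm R g" "?t k \<le> gnorm R h" for k
    using assms by (auto intro!: gnorm_ge)
  have nn: "0 \<le> ?s k" "0 \<le> ?t k" for k
    using assms by auto
  have less: "?s i * ?t j < gnorm R g * gnorm R h" if "i > N \<or> j > M" for i j
  proof (cases "i > N")
    case True
    then have "?s i < gnorm R g" using assms by (simp add: dom_index_def)
    then show ?thesis
      using ge(2)[of j] nn pos
      by (metis mult_left_mono mult_strict_right_mono order_le_less_trans)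
  next
    case False
    then have "?t j < gnorm R h" using assms that by (simp add: dom_index_def)
    then show ?thesis
      using ge(1)[of i] nn pos
      by (metis mult_right_mono mult_strict_left_mono order_le_less_trans)
  qed
  have le: "absv (fps_nth (g * h) k) * R ^ k \<le> gnorm R g * gnorm R h" for k
    using ge nn pos assms(3) by (intro absv_mult_nth_le mult_mono) auto
  have term_less: "absv (fps_nth g i * fps_nth h (k - i)) < gnorm R g * gnorm R h / R ^ k"
    if "i \<le> k" "i > N \<or> k - i > M" for i k
  proof -
    have "R ^ k = R ^ i * R ^ (k - i)"
      using that by (simp flip: power_add)
    then show ?thesis
      using less[OF that(2)] assms(3) by (simp add: field_simps)
  qed
  have big: "absv (fps_nth (g * h) k) * R ^ k < gnorm R g * gnorm R h" if "k > N + M" for k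
  proof -
    have "absv (fps_nth (g * h) k) < gnorm R g * gnorm R h / R ^ k"
      unfolding fps_mult_nth using that pos assms(3)
      by (intro absv_sum_less term_less) auto
    then show ?thesis using assms(3) by (simp add: field_simps)
  qed
  have eq: "absv (fps_nth (g * h) (N + M)) * R ^ (N + M) = gnorm R g * gnorm R h"
  proof -
    let ?f = "\<lambda>i. fps_nth g i * fps_nth h (N + M - i)"
    have "fps_nth (g * h) (N + M) = sum ?f ({0..N + M} - {N}) + ?f N"
      unfolding fps_mult_nth by (subst sum.remove[of _ N]) auto
    moreover have N: "absv (?f N) = gnorm R g * gnorm R h / R ^ (N + M)"
    proof -
      have "gnorm R g = ?s N" "gnorm R h = ?t M"
        using assms by (simp_all add: dom_index_def)
      then show ?thesis
        using assms(3) by (simp add: power_add)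
    qed
    moreover have "absv (sum ?f ({0..N + M} - {N})) < gnorm R g * gnorm R h / R ^ (N + M)"
      using pos assms(3) by (intro absv_sum_less term_less) auto
    ultimately have "absv (fps_nth (g * h) (N + M)) = gnorm R g * gnorm R h / R ^ (N + M)"
      by (simp add: absv_add_eq)
    then show ?thesis using assms(3) by (simp add: field_simps)
  qed
  have "gnorm R (g * h) = gnorm R g * gnorm R h"
    using le eq by (rule gnorm_eqI)
  then show ?thesis
    using eq big by (simp add: dom_index_def)
qed

lemma gnorm_mult:
  assumes "ent g" "ent h" "0 < R"
  shows "gnorm R (g * h) = gnorm R g * gnorm R h"
proof (cases "g = 0 \<or> h = 0")
  case False
  then show ?thesis
    using assms ex_dom_index[of g R] ex_dom_index[of h R] dom_index_mult_aux by blast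
qed auto

lemma dom_index_mult:
  assumes "ent g" "ent h" "0 < R" "g \<noteq> 0" "h \<noteq> 0" "dom_index R g N" "dom_index R h M"
  shows "dom_index R (g * h) (N + M)"
  using dom_index_mult_aux[OF assms] by blast

section \<open>Evaluation and approximation by polynomials\<close>

lemma nlim_ev:
  assumes "ent g"
  shows "nlim (\<lambda>N. \<Sum>k<N. fps_nth g k * z ^ k) (ev g z)"
  unfolding ev_def by (rule nlim_ps_eval) (simp add: entD assms)

lemma ev_eqI:
  assumes "nlim (\<lambda>N. \<Sum>k<N. fps_nth g k * z ^ k) L"
  shows "ev g z = L"
  unfolding ev_def by (rule ps_eval_eqI) (rule assms)

lemma ev_Abs_fps: "ev (Abs_fps a) = ps_eval absv a"
  by (simp add: ev_def Abs_fps_inverse)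

lemma absv_ev_le:
  assumes "ent g" "absv z \<le> R"
  shows "absv (ev g z) \<le> gnorm R g"
  unfolding ev_def
proof (rule absv_ps_eval_le)
  show "(\<lambda>k. absv (fps_nth g k) * absv z ^ k) \<longlonglongrightarrow> 0"
    by (simp add: entD assms)
  fix k
  have "absv (fps_nth g k) * absv z ^ k \<le> gnorm (absv z) g"
    using assms by (intro gnorm_ge) auto
  also have "\<dots> \<le> gnorm R g"
    using assms by (intro gnorm_mono) auto
  finally show "absv (fps_nth g k) * absv z ^ k \<le> gnorm R g" .
qed

lemma ev_add:
  assumes "ent g" "ent h"
  shows "ev (g + h) z = ev g z + ev h z"
  using nlim_add[OF nlim_ev[OF assms(1)] nlim_ev[OF assms(2)], of z z]
  by (intro ev_eqI) (simp add: distrib_right sum.distrib)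

lemma ent_poly [simp, intro]: "ent (fps_of_poly p)"
  unfolding ent_def
proof safe
  fix R :: real
  have "\<forall>\<^sub>F k in sequentially. absv (fps_nth (fps_of_poly p) k) * R ^ k = 0"
    using eventually_gt_at_top[of "degree p"] by eventually_elim (simp add: coeff_eq_0)
  then show "(\<lambda>k. absv (fps_nth (fps_of_poly p) k) * R ^ k) \<longlonglongrightarrow> 0"
    by (rule tendsto_eventually)
qed

lemma ev_poly [simp]: "ev (fps_of_poly p) z = poly p z"
proof (rule ev_eqI)
  have "(\<Sum>k<N. fps_nth (fps_of_poly p) k * z ^ k) = poly p z" if "N > degree p" for N
  proof -
    have "(\<Sum>k<N. coeff p k * z ^ k) = (\<Sum>k\<le>degree p. coeff p k * z ^ k)"
      using that by (intro sum.mono_neutral_right) (auto simp: coeff_eq_0)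
    then show ?thesis by (simp add: poly_altdef)
  qed
  then have "\<forall>\<^sub>F N in sequentially. absv ((\<Sum>k<N. fps_nth (fps_of_poly p) k * z ^ k) - poly p z) = 0"
    by (intro eventually_mono[OF eventually_gt_at_top[of "degree p"]]) simp
  then show "nlim (\<lambda>N. \<Sum>k<N. fps_nth (fps_of_poly p) k * z ^ k) (poly p z)"
    unfolding nlim_def by (rule tendsto_eventually)
qed

lemma ent_const [simp, intro]: "ent (fps_const c)"
  using ent_poly[of "[:c:]"] by (simp add: fps_of_poly_const)

lemma ev_const [simp]: "ev (fps_const c) z = c"
  using ev_poly[of "[:c:]"] by (simp add: fps_of_poly_const)

lemma gnorm_const [simp]: "gnorm R (fps_const c) = absv c"
  by (rule gnorm_eqI[where N = 0]) (auto simp: zero_power)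

lemma ent_0 [simp, intro]: "ent 0" and ent_1 [simp, intro]: "ent 1"
  using ent_const[of 0] ent_const[of 1] by simp_all

lemma ev_0 [simp]: "ev 0 z = 0" and ev_1 [simp]: "ev 1 z = 1"
  using ev_const[of 0 z] ev_const[of 1 z] by simp_all

lemma gnorm_1 [simp]: "gnorm R 1 = 1"
  using gnorm_const[of R 1] by simp

lemma ent_uminus: "ent g \<Longrightarrow> ent (- g)"
  by (simp add: ent_def)

lemma gnorm_uminus [simp]: "gnorm R (- g) = gnorm R g"
  by (simp add: gnorm_def)

lemma ent_diff: "ent g \<Longrightarrow> ent h \<Longrightarrow> ent (g - h)"
  using ent_add[of g "- h"] ent_uminus by simp

lemma ev_uminus: "ent g \<Longrightarrow> ev (- g) z = - ev g z"
  using ev_add[of g "- g" z] ent_uminus by (simp add: eq_neg_iff_add_eq_0 add.commute)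

lemma ev_diff: "ent g \<Longrightarrow> ent h \<Longrightarrow> ev (g - h) z = ev g z - ev h z"
  using ev_add[of g "- h" z] ent_uminus ev_uminus by simp

definition trunc_poly :: "nat \<Rightarrow> 'k fps \<Rightarrow> 'k poly" where
  "trunc_poly N g = (\<Sum>k<N. monom (fps_nth g k) k)"

lemma coeff_trunc_poly: "coeff (trunc_poly N g) k = (if k < N then fps_nth g k else 0)"
  by (simp add: trunc_poly_def coeff_sum)

lemma poly_trunc_poly: "poly (trunc_poly N g) z = (\<Sum>k<N. fps_nth g k * z ^ k)"
  by (simp add: trunc_poly_def poly_sum poly_monom)

text \<open>Approximation in the Gauss norm controls values on a whole disk, so identities for
  polynomials pass to entire series.\<close>

lemma gnorm_tail:
  assumes "ent g" "0 \<le> R"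
  shows "(\<lambda>N. gnorm R (g - fps_of_poly (trunc_poly N g))) \<longlonglongrightarrow> 0"
proof (rule LIMSEQ_I)
  fix e :: real assume e: "e > 0"
  then have "e / 2 > 0" by simp
  from order_tendstoD(2)[OF entD[OF assms] this]
  obtain N where N: "\<And>k. k \<ge> N \<Longrightarrow> absv (fps_nth g k) * R ^ k < e / 2"
    by (auto simp: eventually_sequentially)
  have "gnorm R (g - fps_of_poly (trunc_poly M g)) \<le> e / 2" if "M \<ge> N" for M
  proof (rule gnorm_le)
    fix k show "absv (fps_nth (g - fps_of_poly (trunc_poly M g)) k) * R ^ k \<le> e / 2"
      using N[of k] that e by (auto simp: coeff_trunc_poly)
  qed
  moreover have "0 \<le> gnorm R (g - fps_of_poly (trunc_poly M g))" for M
    using assms by (intro gnorm_nonneg ent_diff ent_poly) auto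
  ultimately show "\<exists>no. \<forall>n\<ge>no. norm (gnorm R (g - fps_of_poly (trunc_poly n g)) - 0) < e"
    using e by (intro exI[of _ N]) (smt (verit, best) field_sum_of_halves real_norm_def)
qed

lemma gnorm_trunc_poly_le:
  assumes "ent g" "0 \<le> R"
  shows "gnorm R (fps_of_poly (trunc_poly N g)) \<le> gnorm R g"
proof (rule gnorm_le)
  fix k show "absv (fps_nth (fps_of_poly (trunc_poly N g)) k) * R ^ k \<le> gnorm R g"
    using gnorm_ge[OF assms, of k] gnorm_nonneg[OF assms] by (simp add: coeff_trunc_poly)
qed

lemma nlim_mult:
  assumes "nlim s L" "nlim t M"
  shows "nlim (\<lambda>k. s k * t k) (L * M)"
proof (rule nlimI_le)
  let ?e = "\<lambda>k. max (max (absv (s k - L)) (absv L) * absv (t k - M)) (absv (s k - L) * absv M)"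
  show "absv (s k * t k - L * M) \<le> ?e k" for k
  proof -
    have "s k * t k - L * M = s k * (t k - M) + (s k - L) * M"
      by (simp add: algebra_simps)
    moreover have "absv (s k) \<le> max (absv (s k - L)) (absv L)"
      using absv_add_le[of "s k - L" L] by simp
    then have "absv (s k * (t k - M)) \<le> max (absv (s k - L)) (absv L) * absv (t k - M)"
      by (simp add: mult_right_mono)
    ultimately show ?thesis
      using absv_add_le[of "s k * (t k - M)" "(s k - L) * M"] by (smt (verit, best) absv_mult)
  qed
  have "?e \<longlonglongrightarrow> max (max 0 (absv L) * 0) (0 * absv M)"
    using assms unfolding nlim_def by (intro tendsto_intros)
  then show "?e \<longlonglongrightarrow> 0" by simp
qed

text \<open>The values of the products of truncations converge to both sides; the error splits as
  p(h - q) + (g - p)h with p, q the truncations of g, h.\<close>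

lemma ev_mult:
  assumes "ent g" "ent h"
  shows "ev (g * h) z = ev g z * ev h z"
proof -
  define R where "R = max 1 (absv z)"
  have R: "0 < R" "0 \<le> R" "absv z \<le> R" by (auto simp: R_def)
  let ?p = "\<lambda>N. fps_of_poly (trunc_poly N g)" and ?q = "\<lambda>N. fps_of_poly (trunc_poly N h)"
  have lim1: "nlim (\<lambda>N. ev (?p N * ?q N) z) (ev g z * ev h z)"
    using nlim_mult[OF nlim_ev[OF assms(1)] nlim_ev[OF assms(2)], of z z]
    by (simp add: poly_trunc_poly flip: fps_of_poly_mult)
  have lim2: "nlim (\<lambda>N. ev (?p N * ?q N) z) (ev (g * h) z)"
  proof (rule nlimI_le)
    let ?e = "\<lambda>N. max (gnorm R g * gnorm R (h - ?q N)) (gnorm R (g - ?p N) * gnorm R h)"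
    show "absv (ev (?p N * ?q N) z - ev (g * h) z) \<le> ?e N" for N
    proof -
      have ents: "ent (?p N * ?q N)" "ent (g * h)" "ent (h - ?q N)" "ent (g - ?p N)" "ent (?p N)"
        "ent (?p N * (h - ?q N))" "ent ((g - ?p N) * h)"
        using assms by (auto intro!: ent_mult ent_diff)
      have "absv (ev (?p N * ?q N) z - ev (g * h) z) = absv (ev (g * h - ?p N * ?q N) z)"
        using ents by (simp add: ev_diff absv_minus_commute)
      also have "\<dots> \<le> gnorm R (g * h - ?p N * ?q N)"
        using ents R by (intro absv_ev_le ent_diff)
      also have "g * h - ?p N * ?q N = ?p N * (h - ?q N) + (g - ?p N) * h"
        by (simp add: algebra_simps)
      also have "gnorm R \<dots> \<le> max (gnorm R (?p N * (h - ?q N))) (gnorm R ((g - ?p N) * h))"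
        using ents R by (intro gnorm_add_le)
      also have "\<dots> = max (gnorm R (?p N) * gnorm R (h - ?q N)) (gnorm R (g - ?p N) * gnorm R h)"
        using ents R assms by (simp add: gnorm_mult)
      also have "\<dots> \<le> ?e N"
        using ents R assms by (intro max.mono mult_right_mono gnorm_trunc_poly_le gnorm_nonneg) auto
      finally show ?thesis .
    qed
    have "?e \<longlonglongrightarrow> max (gnorm R g * 0) (0 * gnorm R h)"
      using assms R by (intro tendsto_intros gnorm_tail)
    then show "?e \<longlonglongrightarrow> 0" by simp
  qed
  from nlim_unique[OF lim2 lim1] show ?thesis .
qed

lemma ent_power: "ent g \<Longrightarrow> ent (g ^ k)"
  by (induction k) (auto intro: ent_mult)

lemma ev_power: "ent g \<Longrightarrow> ev (g ^ k) z = ev g z ^ k"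
  by (induction k) (auto simp: ev_mult ent_power)

section \<open>Linear factors\<close>

definition lin :: "'k \<Rightarrow> 'k fps" where
  "lin w = fps_of_poly [:- w, 1:]"

lemma ent_lin [simp, intro]: "ent (lin w)"
  by (simp add: lin_def)

lemma ev_lin [simp]: "ev (lin w) z = z - w"
  by (simp add: lin_def)

lemma lin_nz [simp]: "lin w \<noteq> 0"
  by (simp add: lin_def)

lemma lin_nth: "fps_nth (lin w) k = (if k = 0 then - w else if k = 1 then 1 else 0)"
  by (simp add: lin_def coeff_pCons split: nat.splits)

lemma gnorm_lin:
  assumes "0 \<le> R"
  shows "gnorm R (lin w) = max R (absv w)"
proof (cases "absv w \<le> R")
  case True
  then show ?thesis
    using assms by (intro gnorm_eqI[where N = 1]) (auto simp: lin_nth)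
next
  case False
  then show ?thesis
    using assms by (intro gnorm_eqI[where N = 0]) (auto simp: lin_nth)
qed

lemma dom_index_lin:
  assumes "0 < R"
  shows "dom_index R (lin w) (if absv w \<le> R then 1 else 0)"
  using assms by (auto simp: dom_index_def gnorm_lin lin_nth)

lemma ent_shift:
  assumes "ent g" "0 \<le> R"
  shows "(\<lambda>j. absv (fps_nth g (j + n)) * R ^ j) \<longlonglongrightarrow> 0"
proof -
  define S where "S = max R 1"
  have S: "S \<ge> R" "S \<ge> 1" by (auto simp: S_def)
  have *: "(\<lambda>j. absv (fps_nth g (j + n)) * S ^ (j + n)) \<longlonglongrightarrow> 0"
    using LIMSEQ_ignore_initial_segment[OF entD[OF assms(1)], of S n] S by auto
  have le: "R ^ j \<le> S ^ (j + n)" for j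
    using S assms(2) by (meson le_add1 order_trans power_increasing power_mono)
  show ?thesis
    using le assms(2) by (intro tendsto_sandwich[OF _ _ tendsto_const *])
      (auto intro!: always_eventually mult_left_mono)
qed

text \<open>Synthetic division from the top: \<open>K n\<close> is the sum of all
  \<open>fps_nth g (j + n) * w ^ j\<close>. It satisfies Horner's recurrence, and \<open>K 0\<close>
  is the value at w, so the coefficients of the quotient are \<open>K (Suc n)\<close>.\<close>

lemma lin_dvd:
  assumes "ent g" "ev g w = 0"
  shows "\<exists>h. ent h \<and> g = lin w * h"
proof -
  define K where "K = (\<lambda>n. ps_eval absv (\<lambda>j. fps_nth g (j + n)) w)"
  define h where "h = Abs_fps (\<lambda>n. K (Suc n))"
  have conv: "(\<lambda>j. absv (fps_nth g (j + n)) * absv w ^ j) \<longlonglongrightarrow> 0" for n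
    using assms(1) by (rule ent_shift) auto
  have K_rec: "K n = fps_nth g n + w * K (Suc n)" for n
    unfolding K_def
  proof (rule ps_eval_eqI)
    let ?s = "\<lambda>N. \<Sum>j<N. fps_nth g (j + n) * w ^ j"
    have "nlim (\<lambda>N. fps_nth g n + w * (\<Sum>j<N. fps_nth g (j + Suc n) * w ^ j))
       (fps_nth g n + w * ps_eval absv (\<lambda>j. fps_nth g (j + Suc n)) w)"
      by (intro nlim_add nlim_cmult nlim_const nlim_ps_eval conv)
    also have "(\<lambda>N. fps_nth g n + w * (\<Sum>j<N. fps_nth g (j + Suc n) * w ^ j)) = (\<lambda>N. ?s (Suc N))"
      by (simp add: sum.lessThan_Suc_shift sum_distrib_left mult_ac del: sum.lessThan_Suc)
    finally show "nlim ?s (fps_nth g n + w * ps_eval absv (\<lambda>j. fps_nth g (j + Suc n)) w)"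
      using nlim_Suc_iff[of ?s] by blast
  qed
  have K0: "K 0 = 0"
    using assms(2) by (simp add: K_def ev_def)
  have "g = lin w * h"
  proof (rule fps_ext)
    fix n
    show "fps_nth g n = fps_nth (lin w * h) n"
    proof (cases n)
      case 0
      then show ?thesis
        using K_rec[of 0] K0 by (simp add: fps_mult_nth lin_nth h_def eq_neg_iff_add_eq_0)
    next
      case (Suc m)
      have "lin w = fps_X - fps_const w"
        by (rule fps_ext) (simp add: lin_nth)
      then show ?thesis
        using K_rec[of n] Suc by (simp add: left_diff_distrib h_def)
    qed
  qed
  moreover have "ent h"
  proof (rule entI_bounded)
    fix R :: real assume R: "R \<ge> absv w" "R \<ge> 1"
    have "absv (fps_nth h k) \<le> gnorm R g / R ^ k" for k
      unfolding h_def K_def fps_nth_Abs_fps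
    proof (rule absv_ps_eval_le[OF conv])
      fix j
      \<comment> \<open>One spare factor R, at least 1, is inserted so that the exponent matches the
        coefficient index j + Suc k.\<close>
      have "absv (fps_nth g (j + Suc k)) * absv w ^ j * R ^ k \<le>
            absv (fps_nth g (j + Suc k)) * R ^ j * R ^ Suc k"
        using R by (intro mult_mono power_mono power_increasing) auto
      also have "\<dots> = absv (fps_nth g (j + Suc k)) * R ^ (j + Suc k)"
        by (simp add: power_add)
      also have "\<dots> \<le> gnorm R g"
        using assms R by (intro gnorm_ge) auto
      finally show "absv (fps_nth g (j + Suc k)) * absv w ^ j \<le> gnorm R g / R ^ k"
        using R by (simp add: pos_le_divide_eq)
    qed
    then have "absv (fps_nth h k) * R ^ k \<le> gnorm R g" for k
      using R by (simp add: pos_le_divide_eq)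
    then show "\<exists>C. \<forall>k. absv (fps_nth h k) * R ^ k \<le> C" by blast
  qed
  ultimately show ?thesis by blast
qed

section \<open>Zeros in disks\<close>

lemma poly_splits:
  fixes p :: "'k poly"
  shows "\<exists>c xs. p = smult c (\<Prod>x\<leftarrow>xs. [:- x, 1:])"
proof (induction "degree p" arbitrary: p)
  case 0
  then obtain c where "p = [:c:]" by (metis degree_eq_zeroE)
  then show ?case by (intro exI[of _ c] exI[of _ "[]"]) simp
next
  case (Suc d)
  obtain z where "poly p z = 0"
    using alg_closed[of p] Suc by auto
  then obtain q where q: "p = [:- z, 1:] * q"
    by (metis poly_eq_0_iff_dvd dvdE)
  then have "q \<noteq> 0" using Suc by auto
  then have "degree p = Suc (degree q)"
    unfolding q by (subst degree_mult_eq) auto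
  then obtain c xs where "q = smult c (\<Prod>x\<leftarrow>xs. [:- x, 1:])"
    using Suc(1)[of q] Suc(2) by auto
  then show ?case
    by (intro exI[of _ c] exI[of _ "z # xs"]) (simp add: q mult_smult_right del: mult_pCons_left)
qed

text \<open>A root outside the disk contributes |y| both to the Gauss norm and to |P(x)|, because |x
  - y| = |y|. A root inside contributes R to the former and |x - y| to the latter, and raises the
  dominant index by one.\<close>

lemma split_poly_dom_index:
  assumes "0 < R" "c \<noteq> 0" "absv x \<le> R"
  defines "P \<equiv> \<lambda>xs. smult c (\<Prod>y\<leftarrow>xs. [:- y, 1:])"
  defines "Q \<equiv> filter (\<lambda>y. absv y \<le> R)"
  shows "dom_index R (fps_of_poly (P xs)) (length (Q xs)) \<and>
    absv (poly (P xs) x) * R ^ length (Q xs) =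
      gnorm R (fps_of_poly (P xs)) * (\<Prod>y\<leftarrow>Q xs. absv (x - y))"
proof (induction xs)
  case Nil
  then show ?case
    using assms(2) by (simp add: P_def Q_def dom_index_def fps_of_poly_const)
next
  case (Cons y ys)
  have P: "P (y # ys) = [:- y, 1:] * P ys"
    by (simp add: P_def mult_smult_right del: mult_pCons_left)
  then have f: "fps_of_poly (P (y # ys)) = lin y * fps_of_poly (P ys)"
    by (simp only: fps_of_poly_mult lin_def)
  have nz: "fps_of_poly (P ys) \<noteq> 0"
    using assms(2) by (auto simp: P_def prod_list_zero_iff)
  have g: "gnorm R (fps_of_poly (P (y # ys))) = max R (absv y) * gnorm R (fps_of_poly (P ys))"
    unfolding f using assms(1) by (simp add: gnorm_mult gnorm_lin)
  have d: "dom_index R (fps_of_poly (P (y # ys)))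
      ((if absv y \<le> R then 1 else 0) + length (Q ys))"
    unfolding f using assms(1) nz Cons by (intro dom_index_mult dom_index_lin) auto
  have e: "absv (poly (P (y # ys)) x) = absv (x - y) * absv (poly (P ys) x)"
    by (simp add: P flip: left_diff_distrib)
  show ?case
  proof (cases "absv y \<le> R")
    case True
    then show ?thesis
      using Cons d e g by (simp add: Q_def mult_ac)
  next
    case False
    then have "absv (x - y) = absv y"
      using absv_add_eq[of x "- y"] assms(3) by simp
    then show ?thesis
      using Cons d e g False by (simp add: Q_def mult_ac)
  qed
qed

lemma power_le_prod_list:
  fixes f :: "'a \<Rightarrow> real"
  assumes "\<And>y. y \<in> set ys \<Longrightarrow> d \<le> f y" "0 \<le> d"
  shows "d ^ length ys \<le> (\<Prod>y\<leftarrow>ys. f y)"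
  using assms by (induction ys) (auto intro!: mult_mono intro: order_trans)

text \<open>There are N roots in the disk, and the N-th power of the smallest distance to x is at
  most the product of the distances. A small value at x therefore forces a root near x.\<close>

lemma poly_near_root:
  assumes "0 < R" "p \<noteq> 0" "absv x \<le> R" "dom_index R (fps_of_poly p) N" "N > 0"
  shows "\<exists>y. poly p y = 0 \<and> absv y \<le> R \<and>
    absv (y - x) ^ N * gnorm R (fps_of_poly p) \<le> absv (poly p x) * R ^ N"
proof -
  obtain c xs where p: "p = smult c (\<Prod>y\<leftarrow>xs. [:- y, 1:])"
    using poly_splits by blast
  have c: "c \<noteq> 0" using assms(2) p by auto
  define ys where "ys = filter (\<lambda>y. absv y \<le> R) xs"
  have *: "dom_index R (fps_of_poly p) (length ys)"
    "absv (poly p x) * R ^ length ys = gnorm R (fps_of_poly p) * (\<Prod>y\<leftarrow>ys. absv (x - y))"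
    using split_poly_dom_index[OF assms(1) c assms(3), of xs] by (simp_all add: p ys_def)
  have N: "length ys = N"
    using dom_index_unique[OF *(1) assms(4)] .
  then have "set ys \<noteq> {}" using assms(5) by auto
  then obtain y where y: "y \<in> set ys" "\<And>y'. y' \<in> set ys \<Longrightarrow> absv (x - y) \<le> absv (x - y')"
    using arg_min_if_finite(1)[of "set ys" "\<lambda>y. absv (x - y)"]
      arg_min_least[of "set ys" _ "\<lambda>y. absv (x - y)"] by blast
  have "absv (x - y) ^ length ys \<le> (\<Prod>y\<leftarrow>ys. absv (x - y))"
    using y(2) by (intro power_le_prod_list) auto
  then have "absv (x - y) ^ length ys * gnorm R (fps_of_poly p) \<le>
      gnorm R (fps_of_poly p) * (\<Prod>y\<leftarrow>ys. absv (x - y))"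
    using assms(1) by (subst mult.commute) (intro mult_left_mono gnorm_nonneg, auto)
  then have "absv (y - x) ^ N * gnorm R (fps_of_poly p) \<le> absv (poly p x) * R ^ N"
    using *(2) N by (simp add: absv_minus_commute)
  moreover have "poly (\<Prod>y\<leftarrow>xs. [:- y, 1:]) y = 0"
  proof -
    have "y \<in> set xs" using y(1) by (simp add: ys_def)
    then show ?thesis by (induction xs) auto
  qed
  then have "poly p y = 0"
    by (simp add: p)
  ultimately show ?thesis
    using y(1) by (auto simp: ys_def)
qed

text \<open>The factor R on the left replaces the exponent k - 1 on the right, which would misbehave
  at k = 0.\<close>

lemma absv_power_diff_le:
  assumes "absv x \<le> R" "absv y \<le> R"
  shows "R * absv (x ^ k - y ^ k) \<le> absv (x - y) * R ^ k"
proof (induction k)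
  case (Suc k)
  have R: "0 \<le> R" using assms(1) absv_nonneg order_trans by blast
  have "x ^ Suc k - y ^ Suc k = x * (x ^ k - y ^ k) + (x - y) * y ^ k"
    by (simp add: algebra_simps)
  then have "absv (x ^ Suc k - y ^ Suc k) \<le>
      max (absv x * absv (x ^ k - y ^ k)) (absv (x - y) * absv y ^ k)"
    using absv_add_le[of "x * (x ^ k - y ^ k)" "(x - y) * y ^ k"] by simp
  also have "\<dots> \<le> absv (x - y) * R ^ k"
  proof (rule max.boundedI)
    have "absv x * absv (x ^ k - y ^ k) \<le> R * absv (x ^ k - y ^ k)"
      using assms by (intro mult_right_mono) auto
    then show "absv x * absv (x ^ k - y ^ k) \<le> absv (x - y) * R ^ k"
      using Suc by linarith
    show "absv (x - y) * absv y ^ k \<le> absv (x - y) * R ^ k"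
      using assms by (intro mult_left_mono power_mono) auto
  qed
  finally show ?case
    using R by (simp add: mult.left_commute mult_left_mono)
qed (use assms in simp)

lemma absv_poly_diff_le:
  assumes "absv x \<le> R" "absv y \<le> R" "0 < R"
  shows "R * absv (poly p x - poly p y) \<le> absv (x - y) * gnorm R (fps_of_poly p)"
proof -
  have "absv (\<Sum>k\<le>degree p. coeff p k * (x ^ k - y ^ k)) \<le> absv (x - y) * gnorm R (fps_of_poly p) / R"
  proof (rule absv_sum_le)
    fix k
    have "absv (coeff p k) * (R * absv (x ^ k - y ^ k)) \<le> absv (coeff p k) * (absv (x - y) * R ^ k)"
      using absv_power_diff_le[OF assms(1,2)] by (intro mult_left_mono) auto
    also have "\<dots> = absv (x - y) * (absv (fps_nth (fps_of_poly p) k) * R ^ k)"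
      by (simp add: mult_ac)
    also have "\<dots> \<le> absv (x - y) * gnorm R (fps_of_poly p)"
      using assms by (intro mult_left_mono gnorm_ge) auto
    finally show "absv (coeff p k * (x ^ k - y ^ k)) \<le> absv (x - y) * gnorm R (fps_of_poly p) / R"
      using assms by (simp add: pos_le_divide_eq mult_ac)
  qed (use assms gnorm_nonneg[OF ent_poly, of R p] in simp)
  moreover have "poly p x - poly p y = (\<Sum>k\<le>degree p. coeff p k * (x ^ k - y ^ k))"
    by (simp add: poly_altdef right_diff_distrib sum_subtractf)
  ultimately show ?thesis
    using assms by (simp add: field_simps)
qed

lemma tendsto_0_of_power:
  fixes u :: "nat \<Rightarrow> real"
  assumes "(\<lambda>k. u k ^ N) \<longlonglongrightarrow> 0" "\<And>k. 0 \<le> u k"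
  shows "u \<longlonglongrightarrow> 0"
proof (rule LIMSEQ_I)
  fix e :: real assume e: "e > 0"
  then have "e ^ N > 0" by simp
  from order_tendstoD(2)[OF assms(1) this]
  obtain K where "\<And>k. k \<ge> K \<Longrightarrow> u k ^ N < e ^ N"
    by (auto simp: eventually_sequentially)
  then have "u k < e" if "k \<ge> K" for k
    using that e by (meson less_imp_le power_less_imp_less_base)
  then show "\<exists>no. \<forall>n\<ge>no. norm (u n - 0) < e"
    using assms(2) by (intro exI[of _ K]) auto
qed

lemma ex_zero:
  assumes g: "ent g" and R: "0 < R" and N: "dom_index R g N" "N > 0"
  shows "\<exists>z. absv z \<le> R \<and> ev g z = 0"
proof -
  \<comment> \<open>Starting at length N + 1 keeps the dominant term in every truncation, so all of
    them share the Gauss norm and the dominant index of g.\<close>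
  define p where "p = (\<lambda>d. trunc_poly (N + 1 + d) g)"
  define m where "m = gnorm R g"
  have "g \<noteq> 0"
    using N by (auto simp: dom_index_def dest: spec[of _ "Suc N"])
  then have m: "m > 0"
    unfolding m_def using g R by (intro gnorm_pos)
  have gp: "gnorm R (fps_of_poly (p d)) = m" for d
    using N R gnorm_ge[OF g, of R] m unfolding p_def
    by (intro gnorm_eqI[where N = N]) (auto simp: coeff_trunc_poly dom_index_def m_def)
  have dp: "dom_index R (fps_of_poly (p d)) N" for d
    using N m unfolding dom_index_def gp
    by (auto simp: m_def p_def coeff_trunc_poly)
  have p0: "p d \<noteq> 0" for d
    using gp[of d] m by auto
  \<comment> \<open>At a root of one truncation the next one takes the value of the single new term.
    That term tends to 0, so the nearest root of the next truncation is close.\<close>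
  have step: "\<exists>y. (poly (p (Suc d)) y = 0 \<and> absv y \<le> R) \<and>
      absv (y - x) ^ N * m \<le> absv (fps_nth g (N + 1 + d)) * R ^ (N + 1 + d) * R ^ N"
    if "poly (p d) x = 0 \<and> absv x \<le> R" for x d
  proof -
    have "poly (p (Suc d)) x = fps_nth g (N + 1 + d) * x ^ (N + 1 + d)"
      using that by (simp add: p_def poly_trunc_poly)
    then have "absv (poly (p (Suc d)) x) \<le> absv (fps_nth g (N + 1 + d)) * R ^ (N + 1 + d)"
      using that by (auto intro!: mult_left_mono power_mono simp del: power_Suc)
    then have "absv (poly (p (Suc d)) x) * R ^ N
        \<le> absv (fps_nth g (N + 1 + d)) * R ^ (N + 1 + d) * R ^ N"
      using R by (intro mult_right_mono) auto
    then show ?thesis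
      using poly_near_root[OF R p0 _ dp N(2), of x "Suc d"] that
      unfolding gp by (meson order_trans)
  qed
  obtain y0 where y0: "poly (p 0) y0 = 0" "absv y0 \<le> R"
    using poly_near_root[OF R p0 _ dp N(2), of 0 0] R by auto
  obtain w where w: "\<And>d. poly (p d) (w d) = 0 \<and> absv (w d) \<le> R"
    "\<And>d. absv (w (Suc d) - w d) ^ N * m \<le> absv (fps_nth g (N + 1 + d)) * R ^ (N + 1 + d) * R ^ N"
    using dependent_nat_choice[of "\<lambda>d x. poly (p d) x = 0 \<and> absv x \<le> R"
      "\<lambda>d x y. absv (y - x) ^ N * m \<le> absv (fps_nth g (N + 1 + d)) * R ^ (N + 1 + d) * R ^ N"]
      step y0 by metis
  have "(\<lambda>d. absv (w (Suc d) - w d)) \<longlonglongrightarrow> 0"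
  proof (rule tendsto_0_of_power)
    have "(\<lambda>d. absv (fps_nth g (d + (N + 1))) * R ^ (d + (N + 1)) * (R ^ N / m)) \<longlonglongrightarrow> 0 * (R ^ N / m)"
      using LIMSEQ_ignore_initial_segment[OF entD[OF g], of R "N + 1"] R
      by (intro tendsto_mult_right) auto
    then have *: "(\<lambda>d. absv (fps_nth g (N + 1 + d)) * R ^ (N + 1 + d) * (R ^ N / m)) \<longlonglongrightarrow> 0"
      by (simp add: add_ac)
    show "(\<lambda>d. absv (w (Suc d) - w d) ^ N) \<longlonglongrightarrow> 0"
      by (rule tendsto_sandwich[OF _ _ tendsto_const *])
        (use w(2) m in \<open>auto simp: pos_le_divide_eq intro!: always_eventually\<close>)
  qed auto
  then obtain z where z: "nlim w z" using nlim_ex by blast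
  have zR: "absv z \<le> R"
    using nlim_absv_le[OF z] w(1) by blast
  \<comment> \<open>The truncations have the common Lipschitz constant m / R on the disk, so their
    values at z are controlled by the distance from z to their roots \<open>w d\<close>.\<close>
  have "nlim (\<lambda>d. poly (p d) z) 0"
  proof (rule nlimI_le)
    fix d
    have "R * absv (poly (p d) z - poly (p d) (w d)) \<le> absv (z - w d) * gnorm R (fps_of_poly (p d))"
      using w(1) zR R by (intro absv_poly_diff_le) auto
    then show "absv (poly (p d) z - 0) \<le> absv (w d - z) * (m / R)"
      using w(1) R by (simp add: gp field_simps absv_minus_commute)
  next
    show "(\<lambda>d. absv (w d - z) * (m / R)) \<longlonglongrightarrow> 0"
      using tendsto_mult_right[OF z[unfolded nlim_def], of "m / R"] by simp
  qed
  moreover have "nlim (\<lambda>d. poly (p d) z) (ev g z)"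
    using LIMSEQ_ignore_initial_segment[OF nlim_ev[OF g, of z, unfolded nlim_def], of "N + 1"]
    by (simp add: nlim_def p_def poly_trunc_poly add_ac)
  ultimately have "ev g z = 0"
    using nlim_unique by blast
  with zR show ?thesis by blast
qed

text \<open>Dividing out a zero in the disk would remove a factor of dominant index 1.\<close>

lemma ev_nonzero_if_dom_index_0:
  assumes "ent g" "g \<noteq> 0" "dom_index R g 0" "0 < R" "absv z \<le> R"
  shows "ev g z \<noteq> 0"
proof
  assume "ev g z = 0"
  then obtain h where h: "ent h" "g = lin z * h"
    using lin_dvd assms(1) by blast
  then have "h \<noteq> 0" using assms(2) by auto
  then obtain M where "dom_index R h M"
    using ex_dom_index h assms(4) by blast
  then have "dom_index R g (1 + M)"
    using dom_index_mult[OF ent_lin h(1) assms(4) lin_nz \<open>h \<noteq> 0\<close> dom_index_lin[OF assms(4), of z]]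
      assms(5) h(2) by simp
  then show False
    using dom_index_unique[OF assms(3)] by fastforce
qed

lemma ent_prod_lin [simp, intro]: "ent (\<Prod>w\<in>#M. lin w)"
  by (induction M) (auto intro: ent_mult)

lemma prod_lin_nz [simp]: "(\<Prod>w\<in>#M. lin w) \<noteq> 0"
  by (induction M) auto

lemma ev_prod_lin_eq_0_iff: "ev (\<Prod>w\<in>#M. lin w) z = 0 \<longleftrightarrow> z \<in># M"
  by (induction M) (auto simp: ev_mult)

text \<open>Induction on the dominant index, which drops by one with each zero divided out. In the
  end \<open>h\<close> behaves like a unit on the disk: its Gauss norm is the absolute value of its
  constant coefficient.\<close>

lemma disk_factor:
  assumes "ent g" "g \<noteq> 0" "0 < R"
  obtains M h where "ent h" "g = (\<Prod>w\<in>#M. lin w) * h" "\<And>w. w \<in># M \<Longrightarrow> absv w \<le> R"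
    "dom_index R h 0" "\<And>z. absv z \<le> R \<Longrightarrow> ev h z \<noteq> 0"
proof -
  obtain N where "dom_index R g N"
    using ex_dom_index assms by blast
  then have "\<exists>M h. ent h \<and> g = (\<Prod>w\<in>#M. lin w) * h \<and> (\<forall>w. w \<in># M \<longrightarrow> absv w \<le> R) \<and> dom_index R h 0"
    using assms(1,2)
  proof (induction N arbitrary: g)
    case 0
    then show ?case by (intro exI[of _ "{#}"] exI[of _ g]) auto
  next
    case (Suc N)
    obtain z where z: "absv z \<le> R" "ev g z = 0"
      using ex_zero[OF Suc(3) assms(3) Suc(2)] by auto
    then obtain h where h: "ent h" "g = lin z * h"
      using lin_dvd Suc by blast
    then have nz: "h \<noteq> 0" using Suc by auto
    then obtain M where M: "dom_index R h M"
      using ex_dom_index h assms(3) by blast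
    then have "dom_index R g (1 + M)"
      using dom_index_mult[OF ent_lin h(1) assms(3) lin_nz nz dom_index_lin[OF assms(3), of z]]
        z(1) h(2) by simp
    then have "M = N"
      using dom_index_unique[OF Suc(2), of "1 + M"] by simp
    then obtain M' h' where "ent h'" "h = (\<Prod>w\<in>#M'. lin w) * h'"
      "\<forall>w. w \<in># M' \<longrightarrow> absv w \<le> R" "dom_index R h' 0"
      using Suc.IH[of h] M h nz by blast
    then show ?case
      using h z by (intro exI[of _ "add_mset z M'"] exI[of _ h']) (auto simp: mult.assoc)
  qed
  then obtain M h where *: "ent h" "g = (\<Prod>w\<in>#M. lin w) * h" "\<And>w. w \<in># M \<Longrightarrow> absv w \<le> R"
    "dom_index R h 0" by blast
  moreover have "ev h z \<noteq> 0" if "absv z \<le> R" for z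
    using ev_nonzero_if_dom_index_0[of h R z] * assms that by auto
  ultimately show ?thesis using that by blast
qed

section \<open>Identity theorem and coefficients of entire functions\<close>

lemma finite_zeros:
  assumes "ent g" "g \<noteq> 0"
  shows "finite {z. absv z \<le> R \<and> ev g z = 0}"
proof -
  define S where "S = max R 1"
  have "S > 0" by (simp add: S_def)
  obtain M h where *: "ent h" "g = (\<Prod>w\<in>#M. lin w) * h" "\<And>z. absv z \<le> S \<Longrightarrow> ev h z \<noteq> 0"
    using disk_factor[OF assms \<open>S > 0\<close>] by blast
  have "{z. absv z \<le> R \<and> ev g z = 0} \<subseteq> set_mset M"
    using *(1,3) by (auto simp: *(2) ev_mult ev_prod_lin_eq_0_iff S_def)
  then show ?thesis
    using finite_subset by blast
qed

text \<open>Otherwise the infinite unit disk would be the union of two finite sets, the zeros and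
  the nonzeros of g in it.\<close>

lemma eq_0_if_ev_ae_0:
  assumes "ent g" "ae_eq absv (ev g) (\<lambda>_. 0)"
  shows "g = 0"
proof (rule ccontr)
  assume "g \<noteq> 0"
  then have "finite {z. absv z \<le> 1 \<and> ev g z = 0}"
    using finite_zeros assms by blast
  moreover have "finite {z. absv z \<le> 1 \<and> ev g z \<noteq> 0}"
    using assms(2) by (simp add: ae_eq_def)
  ultimately have "finite ({z. absv z \<le> 1 \<and> ev g z = 0} \<union> {z. absv z \<le> 1 \<and> ev g z \<noteq> 0})"
    by blast
  moreover have "{z. absv z \<le> 1 \<and> ev g z = 0} \<union> {z. absv z \<le> 1 \<and> ev g z \<noteq> 0} = {z. absv z \<le> 1}"
    by blast
  ultimately show False using infinite_unit_disk by simp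
qed

lemma ev_eq_iff:
  assumes "ent g" "ent h"
  shows "ev g = ev h \<longleftrightarrow> g = h"
proof
  assume "ev g = ev h"
  then have "ae_eq absv (ev (g - h)) (\<lambda>_. 0)"
    using assms by (simp add: ae_eq_def ev_diff)
  then show "g = h"
    using eq_0_if_ev_ae_0[of "g - h"] assms ent_diff by simp
qed auto

lemma entire_fun_iff: "entire_fun absv G \<longleftrightarrow> (\<exists>g. ent g \<and> G = ev g)"
proof
  assume "entire_fun absv G"
  then obtain a where "is_entire_ps absv a" "G = ps_eval absv a"
    by (auto simp: entire_fun_def)
  then show "\<exists>g. ent g \<and> G = ev g"
    using is_entire_ps_iff[of "Abs_fps a"] by (intro exI[of _ "Abs_fps a"]) (simp add: ev_Abs_fps Abs_fps_inverse)
next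
  assume "\<exists>g. ent g \<and> G = ev g"
  then show "entire_fun absv G"
    unfolding entire_fun_def ev_def using is_entire_ps_iff by blast
qed

text \<open>The identity theorem determines the sequence chosen by \<open>SOME\<close>, so
  \<open>mu_ent\<close> really is the Gauss norm.\<close>

lemma ps_coeffs_ev:
  assumes "ent g"
  shows "ps_coeffs absv (ev g) = fps_nth g"
proof -
  have "is_entire_ps absv (ps_coeffs absv (ev g)) \<and> ev g = ps_eval absv (ps_coeffs absv (ev g))"
    unfolding ps_coeffs_def by (rule someI[of _ "fps_nth g"]) (simp add: is_entire_ps_iff assms ev_def)
  then have "ent (Abs_fps (ps_coeffs absv (ev g)))" "ev g = ev (Abs_fps (ps_coeffs absv (ev g)))"
    using is_entire_ps_iff[of "Abs_fps (ps_coeffs absv (ev g))"]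
    by (simp_all add: ev_Abs_fps Abs_fps_inverse)
  then have "g = Abs_fps (ps_coeffs absv (ev g))"
    using assms ev_eq_iff by blast
  then have "fps_nth g = fps_nth (Abs_fps (ps_coeffs absv (ev g)))"
    by (rule arg_cong)
  then show ?thesis by (simp add: Abs_fps_inverse)
qed

lemma mu_ent_ev: "ent g \<Longrightarrow> mu_ent absv R (ev g) = gnorm R g"
  by (simp add: mu_ent_def gnorm_def ps_coeffs_ev)

section \<open>Composition with affine maps\<close>

text \<open>The expansion of g(\<alpha>z + \<beta>) at 0, obtained by applying the binomial theorem
  to each term and collecting powers of z.\<close>

definition aff_comp :: "'k \<Rightarrow> 'k \<Rightarrow> 'k fps \<Rightarrow> 'k fps" where
  "aff_comp \<alpha> \<beta> g =
     Abs_fps (\<lambda>k. \<alpha> ^ k * ps_eval absv (\<lambda>j. of_nat ((j + k) choose k) * fps_nth g (j + k)) \<beta>)"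

lemma aff_comp_conv:
  assumes "ent g"
  shows "(\<lambda>j. absv (of_nat ((j + k) choose k) * fps_nth g (j + k)) * absv \<beta> ^ j) \<longlonglongrightarrow> 0"
proof -
  have *: "(\<lambda>j. absv (fps_nth g (j + k)) * absv \<beta> ^ j) \<longlonglongrightarrow> 0"
    using ent_shift assms by simp
  show ?thesis
    by (rule tendsto_sandwich[OF _ _ tendsto_const *])
      (auto intro!: always_eventually mult_right_mono mult_left_le_one_le absv_of_nat_le_1)
qed

text \<open>Binomial coefficients are integers, hence of absolute value at most 1, and powers of
  \<beta> are bounded by powers of R.\<close>

lemma aff_comp_nth_le:
  assumes "ent g" "absv \<alpha> = 1" "absv \<beta> \<le> R" "0 < R"
  shows "absv (fps_nth (aff_comp \<alpha> \<beta> g) k) * R ^ k \<le> gnorm R g"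
proof -
  have "absv (ps_eval absv (\<lambda>j. of_nat ((j + k) choose k) * fps_nth g (j + k)) \<beta>) \<le> gnorm R g / R ^ k"
  proof (rule absv_ps_eval_le[OF aff_comp_conv[OF assms(1)]])
    fix j
    have "absv (of_nat ((j + k) choose k) * fps_nth g (j + k)) * absv \<beta> ^ j \<le>
        absv (fps_nth g (j + k)) * R ^ j"
      using assms(3) by (auto intro!: mult_mono power_mono mult_left_le_one_le absv_of_nat_le_1)
    moreover have "absv (fps_nth g (j + k)) * R ^ (j + k) \<le> gnorm R g"
      using assms by (intro gnorm_ge) auto
    ultimately show "absv (of_nat ((j + k) choose k) * fps_nth g (j + k)) * absv \<beta> ^ j \<le> gnorm R g / R ^ k"
      using assms(4) by (simp add: pos_le_divide_eq power_add mult.assoc)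
        (smt (verit, best) mult.assoc mult_right_mono zero_le_power)
  qed
  then show ?thesis
    using assms(2,4) by (simp add: aff_comp_def pos_le_divide_eq)
qed

lemma ent_aff_comp:
  assumes "ent g" "absv \<alpha> = 1"
  shows "ent (aff_comp \<alpha> \<beta> g)"
proof (rule entI_bounded[of "absv \<beta>"])
  fix R :: real assume "R \<ge> absv \<beta>" "R \<ge> 1"
  then show "\<exists>C. \<forall>k. absv (fps_nth (aff_comp \<alpha> \<beta> g) k) * R ^ k \<le> C"
    using aff_comp_nth_le[OF assms, of \<beta> R] by auto
qed

lemma aff_comp_add:
  assumes "ent g" "ent h"
  shows "aff_comp \<alpha> \<beta> (g + h) = aff_comp \<alpha> \<beta> g + aff_comp \<alpha> \<beta> h"
proof (rule fps_ext)
  fix k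
  have "ps_eval absv (\<lambda>j. of_nat ((j + k) choose k) * fps_nth (g + h) (j + k)) \<beta> =
     ps_eval absv (\<lambda>j. of_nat ((j + k) choose k) * fps_nth g (j + k)) \<beta> +
     ps_eval absv (\<lambda>j. of_nat ((j + k) choose k) * fps_nth h (j + k)) \<beta>"
    using nlim_add[OF nlim_ps_eval[OF aff_comp_conv[OF assms(1)]]
        nlim_ps_eval[OF aff_comp_conv[OF assms(2)]], of k \<beta> k \<beta>]
    by (intro ps_eval_eqI) (simp add: algebra_simps sum.distrib)
  then show "fps_nth (aff_comp \<alpha> \<beta> (g + h)) k = fps_nth (aff_comp \<alpha> \<beta> g + aff_comp \<alpha> \<beta> h) k"
    by (simp add: aff_comp_def distrib_left)
qed

lemma ev_aff_comp_monom:
  "ev (aff_comp \<alpha> \<beta> (fps_of_poly (monom c n))) z = c * (\<alpha> * z + \<beta>) ^ n"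
proof -
  have "aff_comp \<alpha> \<beta> (fps_of_poly (monom c n)) =
      fps_of_poly (\<Sum>k\<le>n. monom (\<alpha> ^ k * (of_nat (n choose k) * c * \<beta> ^ (n - k))) k)"
  proof (rule fps_ext)
    fix k
    let ?s = "\<lambda>j. of_nat ((j + k) choose k) * fps_nth (fps_of_poly (monom c n)) (j + k)"
    have "Abs_fps ?s = fps_of_poly (if k \<le> n then monom (of_nat (n choose k) * c) (n - k) else 0)"
      by (rule fps_ext) auto
    then have "ps_eval absv ?s \<beta> = (if k \<le> n then of_nat (n choose k) * c * \<beta> ^ (n - k) else 0)"
      unfolding ev_Abs_fps[symmetric] by (simp add: poly_monom)
    then show "fps_nth (aff_comp \<alpha> \<beta> (fps_of_poly (monom c n))) k =
      fps_nth (fps_of_poly (\<Sum>k\<le>n. monom (\<alpha> ^ k * (of_nat (n choose k) * c * \<beta> ^ (n - k))) k)) k"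
      unfolding aff_comp_def fps_nth_Abs_fps by (simp add: coeff_sum)
  qed
  then show ?thesis
    by (simp add: poly_sum poly_monom binomial_ring sum_distrib_left power_mult_distrib mult_ac)
qed

lemma ev_aff_comp_trunc_poly:
  assumes "absv \<alpha> = 1"
  shows "ev (aff_comp \<alpha> \<beta> (fps_of_poly (trunc_poly N g))) z = poly (trunc_poly N g) (\<alpha> * z + \<beta>)"
proof (induction N)
  case 0
  then show ?case
    using ev_aff_comp_monom[of \<alpha> \<beta> 0 0 z] by (simp add: trunc_poly_def)
next
  case (Suc N)
  have "trunc_poly (Suc N) g = trunc_poly N g + monom (fps_nth g N) N"
    by (simp add: trunc_poly_def)
  then show ?case
    using Suc assms
    by (simp add: fps_of_poly_add aff_comp_add ev_add ent_aff_comp ev_aff_comp_monom poly_monom)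
qed

text \<open>True for truncations by the binomial theorem. The tails are harmless because
  \<open>aff_comp\<close> is additive and does not increase the Gauss norm at radii R with |\<beta>|
  \<le> R.\<close>

lemma ev_aff_comp:
  assumes "ent g" "absv \<alpha> = 1"
  shows "ev (aff_comp \<alpha> \<beta> g) z = ev g (\<alpha> * z + \<beta>)"
proof -
  define R where "R = max 1 (max (absv z) (absv \<beta>))"
  have R: "0 < R" "absv z \<le> R" "absv \<beta> \<le> R" by (auto simp: R_def)
  let ?p = "\<lambda>N. fps_of_poly (trunc_poly N g)"
  have lim1: "nlim (\<lambda>N. ev (aff_comp \<alpha> \<beta> (?p N)) z) (ev g (\<alpha> * z + \<beta>))"
    using nlim_ev[OF assms(1)] assms(2) by (simp add: ev_aff_comp_trunc_poly poly_trunc_poly)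
  have lim2: "nlim (\<lambda>N. ev (aff_comp \<alpha> \<beta> (?p N)) z) (ev (aff_comp \<alpha> \<beta> g) z)"
  proof (rule nlimI_le)
    fix N
    have e: "ent (g - ?p N)" using assms by (intro ent_diff) auto
    have "aff_comp \<alpha> \<beta> g = aff_comp \<alpha> \<beta> (g - ?p N) + aff_comp \<alpha> \<beta> (?p N)"
      using aff_comp_add[OF e ent_poly, of \<alpha> \<beta> "trunc_poly N g"] by simp
    then have "ev (aff_comp \<alpha> \<beta> g) z - ev (aff_comp \<alpha> \<beta> (?p N)) z = ev (aff_comp \<alpha> \<beta> (g - ?p N)) z"
      using e assms by (simp add: ev_add ent_aff_comp)
    moreover have "absv (ev (aff_comp \<alpha> \<beta> (g - ?p N)) z) \<le> gnorm R (aff_comp \<alpha> \<beta> (g - ?p N))"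
      using e assms R by (intro absv_ev_le ent_aff_comp)
    moreover have "\<dots> \<le> gnorm R (g - ?p N)"
      using e assms R by (intro gnorm_le aff_comp_nth_le)
    ultimately show "absv (ev (aff_comp \<alpha> \<beta> (?p N)) z - ev (aff_comp \<alpha> \<beta> g) z) \<le> gnorm R (g - ?p N)"
      by (simp add: absv_minus_commute)
  qed (use gnorm_tail assms R in simp)
  from nlim_unique[OF lim2 lim1] show ?thesis .
qed

text \<open>The inverse map z/\<alpha> - \<beta>/\<alpha> satisfies the same hypotheses, so the
  one-sided bound applies in both directions.\<close>

lemma gnorm_aff_comp:
  assumes "ent g" "absv \<alpha> = 1" "absv \<beta> \<le> R" "0 < R"
  shows "gnorm R (aff_comp \<alpha> \<beta> g) = gnorm R g"
proof (rule antisym)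
  show "gnorm R (aff_comp \<alpha> \<beta> g) \<le> gnorm R g"
    using assms by (intro gnorm_le aff_comp_nth_le)
  have nz: "\<alpha> \<noteq> 0" using assms(2) by auto
  let ?a = "inverse \<alpha>" and ?b = "- \<beta> / \<alpha>"
  have ab: "absv ?a = 1" "absv ?b \<le> R" using assms by auto
  have e: "ent (aff_comp \<alpha> \<beta> g)" using assms by (intro ent_aff_comp)
  have "ev (aff_comp ?a ?b (aff_comp \<alpha> \<beta> g)) = ev g"
    using assms e ab nz by (auto simp: ev_aff_comp fun_eq_iff field_simps)
  then have "g = aff_comp ?a ?b (aff_comp \<alpha> \<beta> g)"
    using ev_eq_iff assms e ab ent_aff_comp by metis
  then have "gnorm R g = gnorm R (aff_comp ?a ?b (aff_comp \<alpha> \<beta> g))" by simp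
  also have "\<dots> \<le> gnorm R (aff_comp \<alpha> \<beta> g)"
    using assms e ab by (intro gnorm_le aff_comp_nth_le)
  finally show "gnorm R g \<le> gnorm R (aff_comp \<alpha> \<beta> g)" .
qed

section \<open>Meromorphic functions\<close>

text \<open>As a filter, identities off thin sets can be combined by \<open>eventually_elim\<close>
  with no bookkeeping of exceptional points.\<close>

definition cothin :: "'k filter" where
  "cothin = Abs_filter (\<lambda>P. \<forall>r. finite {z. absv z \<le> r \<and> \<not> P z})"

lemma eventually_cothin: "eventually P cothin \<longleftrightarrow> (\<forall>r. finite {z. absv z \<le> r \<and> \<not> P z})"
  unfolding cothin_def
proof (rule eventually_Abs_filter, rule is_filter.intro, goal_cases)
  case (2 P Q)
  have "{z. absv z \<le> r \<and> \<not> (P z \<and> Q z)} = {z. absv z \<le> r \<and> \<not> P z} \<union> {z. absv z \<le> r \<and> \<not> Q z}" for r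
    by blast
  with 2 show ?case by simp
next
  case (3 P Q)
  have "{z. absv z \<le> r \<and> \<not> Q z} \<subseteq> {z. absv z \<le> r \<and> \<not> P z}" for r
    using 3 by blast
  with 3 show ?case using finite_subset by meson
qed simp

lemma ae_eq_iff: "ae_eq absv f g \<longleftrightarrow> (\<forall>\<^sub>F z in cothin. f z = g z)"
  by (simp add: ae_eq_def eventually_cothin)

lemma cothin_neq_bot: "cothin \<noteq> bot"
  using infinite_unit_disk by (auto simp: trivial_limit_def eventually_cothin)

lemma eventually_ev_nonzero:
  assumes "ent g" "g \<noteq> 0"
  shows "\<forall>\<^sub>F z in cothin. ev g z \<noteq> 0"
  using finite_zeros[OF assms] by (simp add: eventually_cothin)

lemma eventually_neq: "\<forall>\<^sub>F z in cothin. z \<noteq> w"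
  by (simp add: eventually_cothin)

text \<open>The map is injective and sends the disk of radius r into the disk of radius max r
  |\<beta>|, so exceptional sets pull back to thin sets.\<close>

lemma eventually_cothin_affine:
  assumes "eventually P cothin" "absv \<alpha> = 1"
  shows "\<forall>\<^sub>F z in cothin. P (\<alpha> * z + \<beta>)"
  unfolding eventually_cothin
proof
  fix r
  have nz: "\<alpha> \<noteq> 0" using assms(2) by auto
  show "finite {z. absv z \<le> r \<and> \<not> P (\<alpha> * z + \<beta>)}"
  proof (rule finite_imageD)
    have "(\<lambda>z. \<alpha> * z + \<beta>) ` {z. absv z \<le> r \<and> \<not> P (\<alpha> * z + \<beta>)}
        \<subseteq> {z. absv z \<le> max r (absv \<beta>) \<and> \<not> P z}"
    proof safe
      fix z assume "absv z \<le> r"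
      then show "absv (\<alpha> * z + \<beta>) \<le> max r (absv \<beta>)"
        using absv_add_le[of "\<alpha> * z" \<beta>] assms(2) by auto
    qed
    then show "finite ((\<lambda>z. \<alpha> * z + \<beta>) ` {z. absv z \<le> r \<and> \<not> P (\<alpha> * z + \<beta>)})"
      using assms(1) finite_subset unfolding eventually_cothin by blast
    show "inj_on (\<lambda>z. \<alpha> * z + \<beta>) {z. absv z \<le> r \<and> \<not> P (\<alpha> * z + \<beta>)}"
      using nz by (auto intro: inj_onI)
  qed
qed

text \<open>The counterpart of \<open>merom_rep\<close> for power series, where Gauss norms and
  divisibility live.\<close>

definition rep :: "('k \<Rightarrow> 'k) \<Rightarrow> 'k fps \<Rightarrow> 'k fps \<Rightarrow> bool" where
  "rep f g h \<longleftrightarrow> ent g \<and> ent h \<and> h \<noteq> 0 \<and> (\<forall>\<^sub>F z in cothin. f z = ev g z / ev h z)"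

lemma repD:
  assumes "rep f g h"
  shows "ent g" "ent h" "h \<noteq> 0" "\<forall>\<^sub>F z in cothin. f z = ev g z / ev h z"
    "\<forall>\<^sub>F z in cothin. ev h z \<noteq> 0"
  using assms eventually_ev_nonzero by (auto simp: rep_def)

lemma merom_rep_iff: "merom_rep absv f G H \<longleftrightarrow> (\<exists>g h. G = ev g \<and> H = ev h \<and> rep f g h)"
proof -
  have *: "ev h = (\<lambda>_. 0) \<longleftrightarrow> h = 0" if "ent h" for h
    using ev_eq_iff[OF that ent_0] by (simp add: fun_eq_iff)
  show ?thesis
  proof
    assume "merom_rep absv f G H"
    then obtain g h where "ent g" "G = ev g" "ent h" "H = ev h" "ev h \<noteq> (\<lambda>_. 0)"
      "\<forall>\<^sub>F z in cothin. f z = ev g z / ev h z"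
      by (auto simp: merom_rep_def entire_fun_iff ae_eq_iff)
    then show "\<exists>g h. G = ev g \<and> H = ev h \<and> rep f g h"
      using *[of h] by (auto simp: rep_def)
  next
    assume "\<exists>g h. G = ev g \<and> H = ev h \<and> rep f g h"
    then obtain g h where "G = ev g" "H = ev h" "rep f g h" by blast
    then show "merom_rep absv f G H"
      using *[of h] by (auto simp: rep_def merom_rep_def entire_fun_iff ae_eq_iff)
  qed
qed

lemma meromorphic_iff: "meromorphic absv f \<longleftrightarrow> (\<exists>g h. rep f g h)"
  unfolding meromorphic_def merom_rep_iff by blast

text \<open>The reason why quantities defined through an arbitrary quotient are well defined, and
  the way to compare zero orders of two denominators.\<close>

lemma rep_unique:
  assumes "rep f g h" "rep f g' h'"
  shows "g * h' = g' * h"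
proof -
  note r = repD[OF assms(1)] and r' = repD[OF assms(2)]
  have "\<forall>\<^sub>F z in cothin. ev (g * h' - g' * h) z = 0"
    using r(4,5) r'(4,5)
    by eventually_elim (use r r' in \<open>simp add: ev_diff ev_mult ent_mult frac_eq_eq\<close>)
  then have "g * h' - g' * h = 0"
    using r(1-3) r'(1-3) by (intro eq_0_if_ev_ae_0 ent_diff ent_mult) (simp_all add: ae_eq_iff)
  then show ?thesis by simp
qed

lemma mu_merom_eq:
  assumes "rep f g h" "0 < R"
  shows "mu_merom absv R f = gnorm R g / gnorm R h"
proof -
  have "gnorm R g' / gnorm R h' = gnorm R g / gnorm R h" if "rep f g' h'" for g' h'
  proof -
    note r = repD[OF assms(1)] and r' = repD[OF that]
    have "gnorm R (g * h') = gnorm R (g' * h)"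
      using rep_unique[OF assms(1) that] by simp
    moreover have "gnorm R h > 0" "gnorm R h' > 0"
      using r r' assms(2) by (auto intro: gnorm_pos)
    ultimately show ?thesis
      using r r' assms(2) by (simp add: gnorm_mult frac_eq_eq)
  qed
  then have *: "m = gnorm R g / gnorm R h"
    if "merom_rep absv f G H" "m = mu_ent absv R G / mu_ent absv R H" for m G H
    using that repD(1,2) by (auto simp: merom_rep_iff mu_ent_ev)
  have "merom_rep absv f (ev g) (ev h)"
    using assms(1) merom_rep_iff by blast
  moreover have "gnorm R g / gnorm R h = mu_ent absv R (ev g) / mu_ent absv R (ev h)"
    using repD(1,2)[OF assms(1)] by (simp add: mu_ent_ev)
  ultimately show ?thesis
    unfolding mu_merom_def by (intro some_equality) (use * in blast)+
qed

lemma rep_cong: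
  assumes "rep f g h" "\<forall>\<^sub>F z in cothin. f' z = f z"
  shows "rep f' g h"
proof -
  have "\<forall>\<^sub>F z in cothin. f' z = ev g z / ev h z"
    using repD(4)[OF assms(1)] assms(2) by eventually_elim simp
  then show ?thesis using assms(1) by (simp add: rep_def)
qed

lemma rep_const: "rep (\<lambda>_. c) (fps_const c) 1"
  by (simp add: rep_def)

lemma rep_add:
  assumes "rep f g h" "rep f' g' h'"
  shows "rep (\<lambda>z. f z + f' z) (g * h' + g' * h) (h * h')"
proof -
  note r = repD[OF assms(1)] and r' = repD[OF assms(2)]
  have "\<forall>\<^sub>F z in cothin. f z + f' z = ev (g * h' + g' * h) z / ev (h * h') z"
    using r(4,5) r'(4,5)
    by eventually_elim (use r r' in \<open>simp add: ev_add ev_mult ent_mult add_frac_eq\<close>)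
  then show ?thesis
    using r r' by (simp add: rep_def ent_add ent_mult)
qed

lemma rep_mult:
  assumes "rep f g h" "rep f' g' h'"
  shows "rep (\<lambda>z. f z * f' z) (g * g') (h * h')"
proof -
  note r = repD[OF assms(1)] and r' = repD[OF assms(2)]
  have "\<forall>\<^sub>F z in cothin. f z * f' z = ev (g * g') z / ev (h * h') z"
    using r(4,5) r'(4,5)
    by eventually_elim (use r r' in \<open>simp add: ev_mult\<close>)
  then show ?thesis
    using r r' by (simp add: rep_def ent_mult)
qed

lemma rep_uminus:
  assumes "rep f g h"
  shows "rep (\<lambda>z. - f z) (- g) h"
proof -
  note r = repD[OF assms]
  have "\<forall>\<^sub>F z in cothin. - f z = ev (- g) z / ev h z"
    using r(4) by eventually_elim (use r in \<open>simp add: ev_uminus\<close>)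
  then show ?thesis
    using r by (simp add: rep_def ent_uminus)
qed

lemma rep_inverse:
  assumes "rep f g h" "g \<noteq> 0"
  shows "rep (\<lambda>z. inverse (f z)) h g"
proof -
  note r = repD[OF assms(1)]
  have "\<forall>\<^sub>F z in cothin. inverse (f z) = ev h z / ev g z"
    using r(4) by eventually_elim simp
  then show ?thesis
    using r assms(2) by (simp add: rep_def)
qed

lemma rep_affine:
  assumes "rep f g h" "absv \<alpha> = 1"
  shows "rep (\<lambda>z. f (\<alpha> * z + \<beta>)) (aff_comp \<alpha> \<beta> g) (aff_comp \<alpha> \<beta> h)"
proof -
  note r = repD[OF assms(1)]
  \<comment> \<open>Norm invariance at one sufficiently large radius shows that the composed
    denominator is not the zero series.\<close>
  have "gnorm (max 1 (absv \<beta>)) (aff_comp \<alpha> \<beta> h) > 0"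
    using r assms(2) by (subst gnorm_aff_comp) (auto intro: gnorm_pos)
  then have "aff_comp \<alpha> \<beta> h \<noteq> 0" by auto
  moreover have "\<forall>\<^sub>F z in cothin. f (\<alpha> * z + \<beta>) = ev (aff_comp \<alpha> \<beta> g) z / ev (aff_comp \<alpha> \<beta> h) z"
    using eventually_cothin_affine[OF r(4) assms(2)] r assms(2) by (simp add: ev_aff_comp)
  ultimately show ?thesis
    using r assms(2) by (simp add: rep_def ent_aff_comp)
qed

lemma rep_eq_0_iff:
  assumes "rep f g h"
  shows "g = 0 \<longleftrightarrow> ae_eq absv f (\<lambda>_. 0)"
proof
  assume "g = 0"
  then show "ae_eq absv f (\<lambda>_. 0)"
    using repD(4)[OF assms] by (simp add: ae_eq_iff)
next
  assume *: "ae_eq absv f (\<lambda>_. 0)"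
  have "\<forall>\<^sub>F z in cothin. ev g z = 0"
    using *[unfolded ae_eq_iff] repD(4,5)[OF assms] by eventually_elim simp
  then show "g = 0"
    using repD[OF assms] by (intro eq_0_if_ev_ae_0) (auto simp: ae_eq_iff)
qed

lemma rep_scale:
  assumes "rep f g h" "c \<noteq> 0"
  shows "rep f (fps_const c * g) (fps_const c * h)"
proof -
  have "rep (\<lambda>_. 1) (fps_const c) (fps_const c)"
    using assms(2) by (simp add: rep_def)
  from rep_mult[OF this assms(1)] show ?thesis by simp
qed

lemma rep_cancel_lin:
  assumes "rep f (lin w * g) (lin w * h)" "ent g" "ent h"
  shows "rep f g h"
proof -
  have "\<forall>\<^sub>F z in cothin. f z = ev g z / ev h z"
    using repD(4)[OF assms(1)] eventually_neq[of w]
    by eventually_elim (use assms in \<open>simp add: ev_mult\<close>)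
  then show ?thesis
    using assms by (auto simp: rep_def)
qed

section \<open>The Gauss norm as an absolute value on meromorphic functions\<close>

lemma mu_merom_nonneg:
  assumes "meromorphic absv f" "0 < R"
  shows "0 \<le> mu_merom absv R f"
proof -
  obtain g h where r: "rep f g h" using assms(1) meromorphic_iff by blast
  then show ?thesis
    using repD(1,2)[OF r] assms(2) by (simp add: mu_merom_eq[OF r] gnorm_nonneg)
qed

lemma mu_merom_pos:
  assumes "meromorphic absv f" "0 < R" "\<not> ae_eq absv f (\<lambda>_. 0)"
  shows "0 < mu_merom absv R f"
proof -
  obtain g h where r: "rep f g h" using assms(1) meromorphic_iff by blast
  then show ?thesis
    using assms repD(1-3)[OF r] rep_eq_0_iff[OF r] by (simp add: mu_merom_eq[OF r] gnorm_pos)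
qed

lemma mu_merom_cong:
  assumes "meromorphic absv f" "0 < R" "ae_eq absv f' f"
  shows "mu_merom absv R f' = mu_merom absv R f"
proof -
  obtain g h where r: "rep f g h" using assms(1) meromorphic_iff by blast
  then have r': "rep f' g h"
    using assms(3) unfolding ae_eq_iff by (rule rep_cong)
  show ?thesis
    using assms(2) by (simp add: mu_merom_eq[OF r] mu_merom_eq[OF r'])
qed

lemma meromorphic_const [simp]: "meromorphic absv (\<lambda>_. c)"
  unfolding meromorphic_iff by (intro exI) (rule rep_const)

lemma mu_merom_const: "0 < R \<Longrightarrow> mu_merom absv R (\<lambda>_. c) = absv c"
  using mu_merom_eq[OF rep_const[of c]] by simp

lemma meromorphic_add:
  "meromorphic absv f \<Longrightarrow> meromorphic absv g \<Longrightarrow> meromorphic absv (\<lambda>z. f z + g z)"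
  unfolding meromorphic_iff by (elim exE) (intro exI, rule rep_add)

lemma meromorphic_mult:
  "meromorphic absv f \<Longrightarrow> meromorphic absv g \<Longrightarrow> meromorphic absv (\<lambda>z. f z * g z)"
  unfolding meromorphic_iff by (elim exE) (intro exI, rule rep_mult)

lemma meromorphic_uminus: "meromorphic absv f \<Longrightarrow> meromorphic absv (\<lambda>z. - f z)"
  unfolding meromorphic_iff by (elim exE) (intro exI, rule rep_uminus)

lemma meromorphic_diff:
  "meromorphic absv f \<Longrightarrow> meromorphic absv g \<Longrightarrow> meromorphic absv (\<lambda>z. f z - g z)"
  using meromorphic_add[OF _ meromorphic_uminus] by simp

lemma meromorphic_affine:
  "meromorphic absv f \<Longrightarrow> absv \<alpha> = 1 \<Longrightarrow> meromorphic absv (\<lambda>z. f (\<alpha> * z + \<beta>))"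
  unfolding meromorphic_iff by (elim exE) (intro exI, rule rep_affine)

lemma mu_merom_mult:
  assumes "meromorphic absv f" "meromorphic absv g" "0 < R"
  shows "mu_merom absv R (\<lambda>z. f z * g z) = mu_merom absv R f * mu_merom absv R g"
proof -
  obtain u v u' v' where r: "rep f u v" "rep g u' v'"
    using assms meromorphic_iff by blast
  then show ?thesis
    using mu_merom_eq[OF rep_mult[OF r]] assms(3) repD(1,2)[OF r(1)] repD(1,2)[OF r(2)]
    by (simp add: mu_merom_eq[OF r(1)] mu_merom_eq[OF r(2)] gnorm_mult)
qed

lemma mu_merom_uminus:
  assumes "meromorphic absv f" "0 < R"
  shows "mu_merom absv R (\<lambda>z. - f z) = mu_merom absv R f"
proof -
  obtain g h where r: "rep f g h" using assms(1) meromorphic_iff by blast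
  from mu_merom_eq[OF rep_uminus[OF r] assms(2)] show ?thesis
    by (simp add: mu_merom_eq[OF r assms(2)])
qed

lemma mu_merom_add_le:
  assumes "meromorphic absv f" "meromorphic absv g" "0 < R"
  shows "mu_merom absv R (\<lambda>z. f z + g z) \<le> max (mu_merom absv R f) (mu_merom absv R g)"
proof -
  obtain u v u' v' where r: "rep f u v" "rep g u' v'"
    using assms meromorphic_iff by blast
  note rs = repD(1-3)[OF r(1)] repD(1-3)[OF r(2)]
  have pos: "gnorm R v > 0" "gnorm R v' > 0"
    using rs assms(3) by (auto intro: gnorm_pos)
  have "mu_merom absv R (\<lambda>z. f z + g z) = gnorm R (u * v' + u' * v) / (gnorm R v * gnorm R v')"
    using mu_merom_eq[OF rep_add[OF r] assms(3)] rs assms(3) by (simp add: gnorm_mult)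
  also have "\<dots> \<le> max (gnorm R (u * v')) (gnorm R (u' * v)) / (gnorm R v * gnorm R v')"
    using pos rs assms(3) by (intro divide_right_mono gnorm_add_le ent_mult) auto
  also have "\<dots> = max (gnorm R u / gnorm R v) (gnorm R u' / gnorm R v')"
    using pos rs assms(3) by (simp add: gnorm_mult max_divide_distrib_right)
  finally show ?thesis
    using assms(3) by (simp add: mu_merom_eq[OF r(1)] mu_merom_eq[OF r(2)])
qed

lemma mu_merom_inverse:
  assumes "meromorphic absv f" "0 < R" "\<not> ae_eq absv f (\<lambda>_. 0)"
  shows "mu_merom absv R (\<lambda>z. inverse (f z)) = inverse (mu_merom absv R f)"
proof -
  obtain u v where r: "rep f u v"
    using assms meromorphic_iff by blast
  then have "u \<noteq> 0" using rep_eq_0_iff assms by blast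
  from mu_merom_eq[OF rep_inverse[OF r this] assms(2)] show ?thesis
    by (simp add: mu_merom_eq[OF r assms(2)])
qed

lemma mu_merom_affine:
  assumes "meromorphic absv f" "absv \<alpha> = 1" "absv \<beta> \<le> R" "0 < R"
  shows "mu_merom absv R (\<lambda>z. f (\<alpha> * z + \<beta>)) = mu_merom absv R f"
proof -
  obtain u v where r: "rep f u v"
    using assms meromorphic_iff by blast
  from mu_merom_eq[OF rep_affine[OF r assms(2)] assms(4)] show ?thesis
    using repD(1,2)[OF r] assms by (simp add: mu_merom_eq[OF r assms(4)] gnorm_aff_comp)
qed

section \<open>Orders of zeros and poles\<close>

lemma prod_lin_split:
  "(\<Prod>w\<in>#M. lin w) = lin z ^ count M z * (\<Prod>w\<in>#filter_mset (\<lambda>w. w \<noteq> z) M. lin w)"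
  by (induction M) (auto simp: mult_ac)

lemma zero_order_ev:
  assumes "ent k" "ev k z0 \<noteq> 0"
  shows "zero_order absv (ev ((\<Prod>w\<in>#M. lin w) * k)) z0 = count M z0"
  unfolding zero_order_def
proof (rule Greatest_equality)
  define q where "q = (\<Prod>w\<in>#filter_mset (\<lambda>w. w \<noteq> z0) M. lin w) * k"
  have eq: "(\<Prod>w\<in>#M. lin w) * k = lin z0 ^ count M z0 * q"
    by (subst prod_lin_split[of M z0]) (simp add: q_def mult_ac)
  have q: "ent q" "ev q z0 \<noteq> 0"
    using assms by (auto simp: q_def ev_mult ent_mult ev_prod_lin_eq_0_iff)
  show "\<exists>K. entire_fun absv K \<and> (\<forall>z. ev ((\<Prod>w\<in>#M. lin w) * k) z = (z - z0) ^ count M z0 * K z)"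
    using q by (intro exI[of _ "ev q"]) (auto simp: eq entire_fun_iff ev_mult ent_power ev_power)
  fix y assume "\<exists>K. entire_fun absv K \<and> (\<forall>z. ev ((\<Prod>w\<in>#M. lin w) * k) z = (z - z0) ^ y * K z)"
  then obtain u where u: "ent u" "\<And>z. ev (lin z0 ^ count M z0 * q) z = (z - z0) ^ y * ev u z"
    unfolding eq entire_fun_iff by blast
  then have "ev (lin z0 ^ count M z0 * q) = ev (lin z0 ^ y * u)"
    by (simp add: fun_eq_iff ev_mult ent_power ev_power)
  then have *: "lin z0 ^ count M z0 * q = lin z0 ^ y * u"
    using q u by (subst (asm) ev_eq_iff) (auto intro!: ent_mult ent_power)
  show "y \<le> count M z0"
  proof (rule ccontr)
    assume "\<not> y \<le> count M z0"
    then obtain d where d: "y = count M z0 + Suc d"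
      using less_natE by (metis add_Suc_right not_le)
    \<comment> \<open>A larger exponent would, after cancelling the common power of
      \<open>lin z0\<close>, leave a factor vanishing at z0 in q.\<close>
    have "lin z0 ^ count M z0 * q = lin z0 ^ count M z0 * (lin z0 ^ Suc d * u)"
      using * unfolding d power_add by (simp only: mult.assoc)
    then have "q = lin z0 ^ Suc d * u" by simp
    then have "ev q z0 = 0"
      using u by (simp only: ev_mult ent_power ent_lin ev_power) simp
    then show False using q by simp
  qed
qed

text \<open>If the first denominator had the higher order, it would vanish at z0, so g(z0) would be
  nonzero. Cancelling powers of \<open>lin z0\<close> in g h' = g' h then contradicts this.\<close>

lemma zero_order_le_if_coprime:
  assumes "rep f g h" "rep f g' h'" "\<not> (ev g z0 = 0 \<and> ev h z0 = 0)"
  shows "zero_order absv (ev h) z0 \<le> zero_order absv (ev h') z0"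
proof -
  note r = repD[OF assms(1)] and r' = repD[OF assms(2)]
  define R where "R = max 1 (absv z0)"
  have R: "0 < R" "absv z0 \<le> R" by (auto simp: R_def)
  obtain M k where M: "ent k" "h = (\<Prod>w\<in>#M. lin w) * k" "ev k z0 \<noteq> 0"
    using disk_factor[OF r(2,3) R(1)] R(2) by metis
  obtain M' k' where M': "ent k'" "h' = (\<Prod>w\<in>#M'. lin w) * k'" "ev k' z0 \<noteq> 0"
    using disk_factor[OF r'(2,3) R(1)] R(2) by metis
  have "count M z0 \<le> count M' z0"
  proof (rule ccontr)
    assume c: "\<not> count M z0 \<le> count M' z0"
    then have "z0 \<in># M" by (metis count_inI le0)
    then have "ev h z0 = 0"
      using M by (simp add: ev_mult ev_prod_lin_eq_0_iff)
    with assms(3) have gz: "ev g z0 \<noteq> 0" by simp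
    obtain d where d: "count M z0 = count M' z0 + Suc d"
      using c less_natE by (metis add_Suc_right not_le)
    define q where "q = g * ((\<Prod>w\<in>#filter_mset (\<lambda>w. w \<noteq> z0) M'. lin w) * k')"
    define u where "u = g' * ((\<Prod>w\<in>#filter_mset (\<lambda>w. w \<noteq> z0) M. lin w) * k)"
    have q: "ent q" "ev q z0 \<noteq> 0"
      using M' r gz by (auto simp: q_def ev_mult ent_mult ev_prod_lin_eq_0_iff)
    have u: "ent u" using M r' by (auto simp: u_def intro!: ent_mult)
    have "lin z0 ^ count M' z0 * q = g * h'"
      unfolding M'(2) q_def by (subst prod_lin_split[of M' z0]) (simp add: mult_ac)
    also have "\<dots> = g' * h" by (rule rep_unique[OF assms(1,2)])
    also have "\<dots> = lin z0 ^ count M z0 * u"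
      unfolding M(2) u_def by (subst prod_lin_split[of M z0]) (simp add: mult_ac)
    also have "\<dots> = lin z0 ^ count M' z0 * (lin z0 ^ Suc d * u)"
      unfolding d power_add by (simp only: mult.assoc)
    finally have "q = lin z0 ^ Suc d * u" by simp
    then have "ev q z0 = 0"
      using u by (simp only: ev_mult ent_power ent_lin ev_power) simp
    then show False using q by simp
  qed
  then show ?thesis
    using M M' zero_order_ev by simp
qed

lemma pole_order_eq:
  assumes "rep f g h" "\<not> (ev g z0 = 0 \<and> ev h z0 = 0)"
  shows "pole_order absv f z0 = zero_order absv (ev h) z0"
  unfolding pole_order_def
proof (rule Least_equality)
  show "\<exists>G H. merom_rep absv f G H \<and> zero_order absv H z0 = zero_order absv (ev h) z0"
    using assms(1) merom_rep_iff by blast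
qed (use zero_order_le_if_coprime[OF assms(1) _ assms(2)] in \<open>auto simp: merom_rep_iff\<close>)

text \<open>Each cancelled common zero lowers the dominant index of the denominator by one, so
  cancellation inside the disk terminates.\<close>

lemma ex_coprime_rep:
  assumes "meromorphic absv f" "0 < R"
  obtains g h where "rep f g h" "\<And>z. absv z \<le> R \<Longrightarrow> \<not> (ev g z = 0 \<and> ev h z = 0)"
proof -
  obtain g h where r: "rep f g h" using assms meromorphic_iff by blast
  obtain N where "dom_index R h N"
    using ex_dom_index repD[OF r] assms(2) by blast
  then have "\<exists>g h. rep f g h \<and> (\<forall>z. absv z \<le> R \<longrightarrow> \<not> (ev g z = 0 \<and> ev h z = 0))"
    using r
  proof (induction N arbitrary: g h rule: less_induct)
    case (less N)
    note rs = repD[OF less(3)]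
    show ?case
    proof (cases "\<exists>z. absv z \<le> R \<and> ev g z = 0 \<and> ev h z = 0")
      case True
      then obtain z where z: "absv z \<le> R" "ev g z = 0" "ev h z = 0" by blast
      obtain g' h' where gh: "ent g'" "g = lin z * g'" "ent h'" "h = lin z * h'"
        using lin_dvd z rs by metis
      then have r': "rep f g' h'"
        using less(3) rep_cancel_lin by blast
      obtain N' where N': "dom_index R h' N'"
        using ex_dom_index repD[OF r'] assms(2) by blast
      then have "dom_index R h (1 + N')"
        using dom_index_mult[OF ent_lin gh(3) assms(2) lin_nz repD(3)[OF r'] dom_index_lin[OF assms(2), of z]]
          z(1) gh(4) by simp
      then have "N = 1 + N'"
        using dom_index_unique[OF less(2)] by blast
      then show ?thesis
        using less(1)[OF _ N' r'] by simp
    qed (use less in blast)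
  qed
  then show ?thesis using that by blast
qed

section \<open>Jensen's formula\<close>

text \<open>The share of a single pole w in N: the integral of 1/t from |w| to R. For w = 0 the
  subtraction of n(0, f) makes the integrand vanish.\<close>

lemma has_integral_jump:
  assumes "absv w \<le> R" "0 < R"
  shows "((\<lambda>t. (of_bool (absv w \<le> t) - of_bool (absv w \<le> 0)) / t) has_integral
    (if w = 0 then 0 else ln (R / absv w))) {0..R}"
proof (cases "w = 0")
  case True
  then show ?thesis
    by (auto intro!: has_integral_is_0)
next
  case False
  define \<rho> where "\<rho> = absv w"
  have \<rho>: "0 < \<rho>" "\<rho> \<le> R" using assms False by (auto simp: \<rho>_def)
  have "((\<lambda>t. 1 / t) has_integral (ln R - ln \<rho>)) {\<rho>..R}"
    using \<rho> by (intro fundamental_theorem_of_calculus)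
      (auto intro!: derivative_eq_intros simp: has_real_derivative_iff_has_vector_derivative[symmetric])
  then have "((\<lambda>t. if t \<in> {\<rho>..R} then 1 / t else 0) has_integral (ln R - ln \<rho>)) {0..R}"
    using \<rho> by (subst has_integral_restrict) auto
  then have "((\<lambda>t. (of_bool (\<rho> \<le> t) - of_bool (\<rho> \<le> 0)) / t) has_integral (ln R - ln \<rho>)) {0..R}"
    by (rule has_integral_eq[rotated]) (use \<rho> in auto)
  then show ?thesis
    using False \<rho> by (simp add: \<rho>_def[symmetric] ln_div)
qed

lemma has_integral_jumps:
  assumes "\<And>w. w \<in># M \<Longrightarrow> absv w \<le> R" "0 < R"
  shows "((\<lambda>t. ((\<Sum>w\<in>#M. of_bool (absv w \<le> t)) - (\<Sum>w\<in>#M. of_bool (absv w \<le> 0))) / t) has_integral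
    (\<Sum>w\<in>#M. if w = 0 then 0 else ln (R / absv w))) {0..R}"
  using assms(1)
proof (induction M)
  case (add w M)
  then have *: "((\<lambda>t. ((\<Sum>w\<in>#M. of_bool (absv w \<le> t)) - (\<Sum>w\<in>#M. of_bool (absv w \<le> 0))) / t) has_integral
    (\<Sum>w\<in>#M. if w = 0 then 0 else ln (R / absv w))) {0..R}" by simp
  have "absv w \<le> R" using add by simp
  from has_integral_add[OF has_integral_jump[OF this assms(2)] *] show ?case
    by (simp add: add_divide_distrib diff_divide_distrib algebra_simps)
qed simp

text \<open>Exponentials turn N into a product that can be compared with a Gauss norm. A pole at 0
  contributes the factor R, which comes from the term n(0, f) log R.\<close>

lemma exp_count_N:
  assumes "\<And>z. absv z \<le> R \<Longrightarrow> pole_order absv f z = count M z"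
    and "\<And>w. w \<in># M \<Longrightarrow> absv w \<le> R" "0 < R"
  shows "exp (count_N absv R f) = (\<Prod>w\<in>#M. R / (if w = 0 then 1 else absv w))"
proof -
  have np: "npoles absv t f = (\<Sum>w\<in>#M. of_bool (absv w \<le> t))" if "t \<le> R" for t
  proof -
    have "{z. absv z \<le> t \<and> 0 < pole_order absv f z} = set_mset (filter_mset (\<lambda>w. absv w \<le> t) M)"
      using that assms(1) by auto
    moreover have "pole_order absv f z = count (filter_mset (\<lambda>w. absv w \<le> t) M) z"
      if "z \<in> set_mset (filter_mset (\<lambda>w. absv w \<le> t) M)" for z
      using that \<open>t \<le> R\<close> assms(1)[of z] by simp
    ultimately have "npoles absv t f = real (size (filter_mset (\<lambda>w. absv w \<le> t) M))"
      by (simp add: npoles_def size_multiset_overloaded_eq)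
    also have "\<dots> = (\<Sum>w\<in>#M. of_bool (absv w \<le> t))"
      by (induction M) auto
    finally show ?thesis .
  qed
  have "((\<lambda>t. (npoles absv t f - npoles absv 0 f) / t) has_integral
      (\<Sum>w\<in>#M. if w = 0 then 0 else ln (R / absv w))) {0..R}"
    using has_integral_jumps[OF assms(2,3)]
    by (rule has_integral_eq[rotated]) (use assms(3) np in auto)
  then have "count_N absv R f = (\<Sum>w\<in>#M. if w = 0 then 0 else ln (R / absv w)) +
      (\<Sum>w\<in>#M. of_bool (absv w \<le> 0)) * ln R"
    unfolding count_N_def using np[of 0] assms(3) by (simp add: integral_unique)
  also have "exp \<dots> = (\<Prod>w\<in>#M. R / (if w = 0 then 1 else absv w))"
    using assms(3) by (induction M) (auto simp: exp_add distrib_right field_simps)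
  finally show ?thesis .
qed

section \<open>Normalised denominators\<close>

lemma gnorm_prod_lin:
  assumes "\<And>w. w \<in># M \<Longrightarrow> absv w \<le> R" "0 < R"
  shows "gnorm R (\<Prod>w\<in>#M. lin w) = R ^ size M"
  using assms(1)
proof (induction M)
  case (add w M)
  then have "max R (absv w) = R" by simp
  then show ?case using add assms(2) by (simp add: gnorm_mult gnorm_lin)
qed simp

text \<open>Plays the part of the value at 0 in Jensen's formula and remains nonzero when the series
  vanishes there.\<close>

definition lead :: "'k fps \<Rightarrow> 'k" where
  "lead g = fps_nth g (subdegree g)"

lemma lead_mult: "g \<noteq> 0 \<Longrightarrow> h \<noteq> 0 \<Longrightarrow> lead (g * h) = lead g * lead h"
  by (simp add: lead_def)

lemma lead_lin: "absv (lead (lin w)) = (if w = 0 then 1 else absv w)"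
proof (cases "w = 0")
  case True
  then have "subdegree (lin w) = 1"
    by (intro subdegreeI) (auto simp: lin_nth)
  then show ?thesis using True by (simp add: lead_def lin_nth)
next
  case False
  then have "subdegree (lin w) = 0"
    by (intro subdegreeI) (auto simp: lin_nth)
  then show ?thesis using False by (simp add: lead_def lin_nth)
qed

lemma lead_prod_lin: "absv (lead (\<Prod>w\<in>#M. lin w)) = (\<Prod>w\<in>#M. if w = 0 then 1 else absv w)"
proof (induction M)
  case empty
  then show ?case by (simp add: lead_def)
next
  case (add w M)
  then show ?case by (simp add: lead_mult[OF lin_nz prod_lin_nz] lead_lin)
qed

text \<open>Cancelling the common zeros in the closed disk of radius \<open>R\<close> only avoids constructing a
  global greatest common divisor. Normalising the lowest nonzero coefficient of the denominator
  makes the bounds uniform in \<open>R\<close>.\<close>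

lemma ex_normalized_rep:
  assumes "meromorphic absv f" "0 < R"
  obtains g h where "rep f g h" "gnorm R h = exp (count_N absv R f)"
    "\<And>S. 1 \<le> S \<Longrightarrow> 1 \<le> gnorm S h"
proof -
  obtain g0 h0 where r0: "rep f g0 h0" "\<And>z. absv z \<le> R \<Longrightarrow> \<not> (ev g0 z = 0 \<and> ev h0 z = 0)"
    using ex_coprime_rep[OF assms] by blast
  define c where "c = inverse (lead h0)"
  have l0: "lead h0 \<noteq> 0"
    using repD(3)[OF r0(1)] by (simp add: lead_def)
  then have c: "c \<noteq> 0" by (simp add: c_def)
  define g where "g = fps_const c * g0"
  define h where "h = fps_const c * h0"
  have r: "rep f g h"
    unfolding g_def h_def using r0(1) c by (rule rep_scale)
  note rs = repD[OF r] and rs0 = repD[OF r0(1)]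
  have cop: "\<not> (ev g z = 0 \<and> ev h z = 0)" if "absv z \<le> R" for z
    using r0(2)[OF that] c rs0 by (simp add: g_def h_def ev_mult)
  have "lead (fps_const c) = c" by (simp add: lead_def)
  then have lead: "lead h = 1"
    using l0 c rs0 by (simp add: h_def lead_mult c_def)
  obtain M k where M: "ent k" "h = (\<Prod>w\<in>#M. lin w) * k" "\<And>w. w \<in># M \<Longrightarrow> absv w \<le> R"
    "dom_index R k 0" "\<And>z. absv z \<le> R \<Longrightarrow> ev k z \<noteq> 0"
    using disk_factor[OF rs(2,3) assms(2)] by blast
  have po: "pole_order absv f z = count M z" if "absv z \<le> R" for z
    using pole_order_eq[OF r cop[OF that]] zero_order_ev[OF M(1) M(5)[OF that]] M(2) by simp
  have k0: "k \<noteq> 0" using M rs by auto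
  have gk: "gnorm R k = absv (fps_nth k 0)"
    using M(4) by (simp add: dom_index_def)
  then have "fps_nth k 0 \<noteq> 0"
    using gnorm_pos[OF M(1) assms(2) k0] by auto
  then have "lead k = fps_nth k 0"
    by (simp add: lead_def)
  \<comment> \<open>With leading coefficient 1, the norm of the zero-free factor is the reciprocal
    of the product of the nonzero |w|. Multiplying by R to the number of zeros gives exactly exp
    N.\<close>
  then have "(\<Prod>w\<in>#M. if w = 0 then 1 else absv w) * gnorm R k = absv (lead h)"
    unfolding M(2) by (simp add: lead_mult[OF prod_lin_nz k0] lead_prod_lin gk)
  then have one: "(\<Prod>w\<in>#M. if w = 0 then 1 else absv w) * gnorm R k = 1"
    by (simp add: lead)
  have "gnorm R h = R ^ size M * gnorm R k"
    unfolding M(2) using M assms(2) by (simp add: gnorm_mult gnorm_prod_lin)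
  also have "R ^ size M = (\<Prod>w\<in>#M. R / (if w = 0 then 1 else absv w)) *
      (\<Prod>w\<in>#M. if w = 0 then 1 else absv w)"
    by (induction M) auto
  also have "\<dots> * gnorm R k = (\<Prod>w\<in>#M. R / (if w = 0 then 1 else absv w))"
    using one by (simp add: mult.assoc)
  also have "\<dots> = exp (count_N absv R f)"
    using exp_count_N[OF po M(3) assms(2)] by simp
  finally have "gnorm R h = exp (count_N absv R f)" .
  moreover have "1 \<le> gnorm S h" if "1 \<le> S" for S
  proof -
    have "1 \<le> absv (lead h) * S ^ subdegree h"
      using that by (simp add: lead)
    also have "\<dots> \<le> gnorm S h"
      unfolding lead_def using rs that by (intro gnorm_ge) auto
    finally show ?thesis .
  qed
  ultimately show ?thesis using that r by blast
qed

lemma count_N_nonneg: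
  assumes "meromorphic absv f" "1 \<le> R"
  shows "0 \<le> count_N absv R f"
proof -
  have "0 < R" using assms(2) by simp
  then obtain g h where "gnorm R h = exp (count_N absv R f)" "1 \<le> gnorm R h"
    using ex_normalized_rep[OF assms(1), of R] assms(2) by metis
  then show ?thesis by simp
qed

lemma prox_m_nonneg: "0 \<le> prox_m absv R f"
  by (simp add: prox_m_def)

lemma mu_merom_le_exp_prox_m:
  assumes "meromorphic absv f" "0 < R"
  shows "max 1 (mu_merom absv R f) \<le> exp (prox_m absv R f)"
proof (cases "mu_merom absv R f = 0")
  case False
  then have "mu_merom absv R f > 0"
    using mu_merom_nonneg[OF assms] by simp
  then have "mu_merom absv R f = exp (ln (mu_merom absv R f))" by simp
  also have "\<dots> \<le> exp (prox_m absv R f)"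
    by (simp add: prox_m_def del: exp_ln)
  finally show ?thesis
    by (simp add: prox_m_nonneg)
qed (simp add: prox_m_nonneg)

text \<open>Subtracting its value at a point w gives a numerator divisible by \<open>lin w\<close>,
  whose Gauss norm grows at least linearly in r. Normalised denominators keep the constants
  independent of r.\<close>

lemma char_T_ge_ln:
  assumes "meromorphic absv f" "\<not> (\<exists>C. ae_eq absv f (\<lambda>_. C))"
  obtains C where "\<And>r. C \<le> r \<Longrightarrow> ln r - C \<le> char_T absv r f"
proof -
  obtain g0 h0 where r0: "rep f g0 h0" using assms meromorphic_iff by blast
  note rs0 = repD[OF r0]
  obtain w where w: "ev h0 w \<noteq> 0"
    using eventually_happens'[OF cothin_neq_bot rs0(5)] by blast
  define c where "c = ev g0 w / ev h0 w"
  define r1 where "r1 = max 1 (absv w)"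
  have r1: "1 \<le> r1" "0 < r1" "absv w \<le> r1" by (auto simp: r1_def)
  let ?fc = "\<lambda>z. f z + - c"
  define \<delta> where "\<delta> = mu_merom absv r1 ?fc"
  have "\<not> ae_eq absv ?fc (\<lambda>_. 0)"
    using assms(2) by (auto simp: ae_eq_def)
  then have \<delta>: "\<delta> > 0"
    unfolding \<delta>_def using assms(1) r1 by (intro mu_merom_pos meromorphic_add) auto
  \<comment> \<open>Here \<delta> bounds the numerator of f - c from below at r1, the factor r1 is
    the norm of \<open>lin w\<close> there, and max 1 |c| is the cost of returning from f - c to
    f.\<close>
  define B where "B = \<delta> / (r1 * max 1 (absv c))"
  have B: "B > 0" using \<delta> r1 by (simp add: B_def)
  have main: "ln r + ln B \<le> char_T absv r f" if r: "r1 \<le> r" for r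
  proof -
    have r': "0 < r" "1 \<le> r" using r r1 by auto
    obtain g h where gh: "rep f g h" "gnorm r h = exp (count_N absv r f)"
      "\<And>S. 1 \<le> S \<Longrightarrow> 1 \<le> gnorm S h"
      using ex_normalized_rep[OF assms(1) r'(1)] by blast
    note rs = repD[OF gh(1)]
    define u where "u = g + fps_const (- c) * h"
    have u: "ent u" unfolding u_def using rs by (intro ent_add ent_mult) auto
    have ru: "rep ?fc u h"
      using rep_add[OF gh(1) rep_const[of "- c"]] by (simp add: u_def)
    \<comment> \<open>The pair g, h depends on r and \<open>h\<close> may vanish at w. The
      cross-multiplied identity still gives g(w) = c h(w).\<close>
    have "ev (g * h0) w = ev (g0 * h) w"
      using rep_unique[OF gh(1) r0] by simp
    then have "ev g w = c * ev h w"
      using w rs rs0 by (simp add: ev_mult c_def field_simps)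
    then have "ev u w = 0"
      using rs by (simp add: u_def ev_add ev_mult ent_mult)
    then obtain v where v: "ent v" "u = lin w * v"
      using lin_dvd u by blast
    have "gnorm r1 u = \<delta> * gnorm r1 h"
      using mu_merom_eq[OF ru r1(2)] gnorm_pos[OF rs(2) r1(2) rs(3)] by (simp add: \<delta>_def field_simps)
    then have "\<delta> \<le> gnorm r1 u"
      using gh(3)[OF r1(1)] \<delta> by simp
    also have "gnorm r1 u = r1 * gnorm r1 v"
      using v r1 by (simp add: gnorm_mult gnorm_lin max_def)
    also have "\<dots> \<le> r1 * gnorm r v"
      using v r1 r by (intro mult_left_mono gnorm_mono) auto
    finally have "\<delta> * r \<le> r1 * (r * gnorm r v)"
      using r' by (simp add: mult_ac mult_left_mono)
    also have "r * gnorm r v = gnorm r u"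
      using v r1 r r' by (simp add: gnorm_mult gnorm_lin max_def)
    also have "gnorm r u \<le> max (gnorm r g) (gnorm r (fps_const (- c) * h))"
      unfolding u_def using rs r' by (intro gnorm_add_le ent_mult) auto
    also have "\<dots> \<le> max 1 (absv c) * max (gnorm r g) (gnorm r h)"
    proof (rule max.boundedI)
      have "1 * gnorm r g \<le> max 1 (absv c) * max (gnorm r g) (gnorm r h)"
        using rs r' by (intro mult_mono) (auto intro!: gnorm_nonneg)
      then show "gnorm r g \<le> max 1 (absv c) * max (gnorm r g) (gnorm r h)" by simp
      have "absv c * gnorm r h \<le> max 1 (absv c) * max (gnorm r g) (gnorm r h)"
        using rs r' by (intro mult_mono) (auto intro!: gnorm_nonneg)
      then show "gnorm r (fps_const (- c) * h) \<le> max 1 (absv c) * max (gnorm r g) (gnorm r h)"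
        using rs r' by (simp add: gnorm_mult)
    qed
    finally have "\<delta> * r \<le> r1 * (max 1 (absv c) * max (gnorm r g) (gnorm r h))"
      using r1 by simp
    then have "r * B \<le> max (gnorm r g) (gnorm r h)"
      using r1 by (simp add: B_def divide_le_eq mult_ac)
    \<comment> \<open>The larger of the norms of numerator and denominator is exp T, as for
      heights.\<close>
    also have "\<dots> = max (mu_merom absv r f) 1 * exp (count_N absv r f)"
      using gnorm_pos[OF rs(2) r'(1) rs(3)]
      by (simp add: mu_merom_eq[OF gh(1) r'(1)] gh(2) max_mult_distrib_right)
    also have "\<dots> \<le> exp (prox_m absv r f) * exp (count_N absv r f)"
      using mu_merom_le_exp_prox_m[OF assms(1) r'(1)] by (intro mult_right_mono) auto
    also have "\<dots> = exp (char_T absv r f)"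
      by (simp add: char_T_def exp_add)
    finally have "ln (r * B) \<le> ln (exp (char_T absv r f))"
      using r' B by (subst ln_le_cancel_iff) auto
    then show ?thesis using r' B by (simp add: ln_mult)
  qed
  show ?thesis
  proof (rule that[of "max r1 (- ln B)"])
    fix r assume "max r1 (- ln B) \<le> r"
    then show "ln r - max r1 (- ln B) \<le> char_T absv r f"
      using main[of r] by simp
  qed
qed

text \<open>A surrogate for N(r, f) \<le> log E that is stable under sums and products, since common
  denominators multiply. The lower bound at s prevents rescaling the denominator to make E
  meaningless.\<close>

definition den_bound :: "real \<Rightarrow> real \<Rightarrow> ('k \<Rightarrow> 'k) \<Rightarrow> real \<Rightarrow> bool" where
  "den_bound s r f E \<longleftrightarrow> (\<exists>g h. rep f g h \<and> 1 \<le> gnorm s h \<and> gnorm r h \<le> E)"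

context
  fixes s r :: real
  assumes sr: "1 \<le> s" "s \<le> r"
begin

lemma den_bound_ge_1:
  assumes "den_bound s r f E"
  shows "1 \<le> E"
proof -
  obtain g h where "rep f g h" "1 \<le> gnorm s h" "gnorm r h \<le> E"
    using assms by (auto simp: den_bound_def)
  then show ?thesis
    using gnorm_mono[of h s r] sr repD(2)[of f g h] by simp
qed

lemma den_bound_const: "den_bound s r (\<lambda>_. c) 1"
  unfolding den_bound_def using rep_const[of c] by force

lemma den_bound_combine:
  assumes "den_bound s r f E" "den_bound s r g F"
  shows den_bound_add: "den_bound s r (\<lambda>z. f z + g z) (E * F)"
    and den_bound_mult: "den_bound s r (\<lambda>z. f z * g z) (E * F)"
proof -
  obtain u v where u: "rep f u v" "1 \<le> gnorm s v" "gnorm r v \<le> E"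
    using assms by (auto simp: den_bound_def)
  obtain u' v' where u': "rep g u' v'" "1 \<le> gnorm s v'" "gnorm r v' \<le> F"
    using assms by (auto simp: den_bound_def)
  note rs = repD[OF u(1)] repD[OF u'(1)]
  have "1 * 1 \<le> gnorm s v * gnorm s v'"
    using u u' by (intro mult_mono) auto
  then have 1: "1 \<le> gnorm s (v * v')"
    using rs sr by (simp add: gnorm_mult)
  have "gnorm r v * gnorm r v' \<le> E * F"
    using u u' rs sr den_bound_ge_1[OF assms(1)] by (intro mult_mono gnorm_nonneg) auto
  then have 2: "gnorm r (v * v') \<le> E * F"
    using rs sr by (simp add: gnorm_mult)
  show "den_bound s r (\<lambda>z. f z + g z) (E * F)"
    unfolding den_bound_def using rep_add[OF u(1) u'(1)] 1 2 by blast
  show "den_bound s r (\<lambda>z. f z * g z) (E * F)"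
    unfolding den_bound_def using rep_mult[OF u(1) u'(1)] 1 2 by blast
qed

lemma den_bound_power:
  assumes "den_bound s r f E"
  shows "den_bound s r (\<lambda>z. f z ^ k) (E ^ k)"
proof (induction k)
  case 0
  then show ?case using den_bound_const[of 1] by simp
next
  case (Suc k)
  then show ?case using den_bound_mult[OF assms Suc] by simp
qed

lemma den_bound_sum:
  assumes "finite A" "\<And>i. i \<in> A \<Longrightarrow> den_bound s r (f i) (E i)"
  shows "den_bound s r (\<lambda>z. \<Sum>i\<in>A. f i z) (\<Prod>i\<in>A. E i)"
  using assms
proof (induction A rule: finite_induct)
  case empty
  then show ?case using den_bound_const[of 0] by simp
next
  case (insert i A)
  then show ?case using den_bound_add[of "f i" "E i"] by simp
qed

lemma den_bound_prod:
  assumes "finite A" "\<And>i. i \<in> A \<Longrightarrow> den_bound s r (f i) (E i)"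
  shows "den_bound s r (\<lambda>z. \<Prod>i\<in>A. f i z) (\<Prod>i\<in>A. E i)"
  using assms
proof (induction A rule: finite_induct)
  case empty
  then show ?case using den_bound_const[of 1] by simp
next
  case (insert i A)
  then show ?case using den_bound_mult[of "f i" "E i"] by simp
qed

text \<open>Composition with the affine map changes neither norm of the normalised denominator,
  because |\<beta>| \<le> s \<le> r.\<close>

lemma den_bound_exp_count_N:
  assumes "meromorphic absv f" "absv \<alpha> = 1" "absv \<beta> \<le> s"
  shows "den_bound s r (\<lambda>z. f (\<alpha> * z + \<beta>)) (exp (count_N absv r f))"
proof -
  have "0 < r" using sr by simp
  then obtain g h where gh: "rep f g h" "gnorm r h = exp (count_N absv r f)"
    "\<And>S. 1 \<le> S \<Longrightarrow> 1 \<le> gnorm S h"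
    using ex_normalized_rep[OF assms(1)] by blast
  have "1 \<le> gnorm s (aff_comp \<alpha> \<beta> h)" "gnorm r (aff_comp \<alpha> \<beta> h) \<le> exp (count_N absv r f)"
    using gh(2,3) repD(2)[OF gh(1)] assms sr by (simp_all add: gnorm_aff_comp)
  then show ?thesis
    unfolding den_bound_def using rep_affine[OF gh(1) assms(2), of \<beta>] by blast
qed

text \<open>The numerator grows with the radius, so only the denominator can make \<open>\<mu>\<close> small.\<close>

lemma mu_merom_ge:
  assumes "den_bound s r f E"
  shows "mu_merom absv s f \<le> mu_merom absv r f * E"
proof -
  obtain g h where gh: "rep f g h" "1 \<le> gnorm s h" "gnorm r h \<le> E"
    using assms by (auto simp: den_bound_def)
  note rs = repD[OF gh(1)]
  have r: "0 < r" "0 < s" using sr by auto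
  have pos: "gnorm r h > 0" using rs r by (intro gnorm_pos)
  have gn: "0 \<le> gnorm s g" "0 \<le> gnorm r g" using rs r by (auto intro!: gnorm_nonneg)
  have "gnorm s g / gnorm s h \<le> gnorm s g / 1"
    using gh gn by (intro divide_left_mono) auto
  also have "\<dots> \<le> gnorm r g"
    using gnorm_mono[OF rs(1), of s r] sr by simp
  also have "gnorm r g = gnorm r g / gnorm r h * gnorm r h"
    using pos by simp
  also have "\<dots> \<le> gnorm r g / gnorm r h * E"
    using gh pos gn by (intro mult_left_mono) auto
  finally show ?thesis
    using r by (simp add: mu_merom_eq[OF gh(1)])
qed

end

text \<open>Relative closeness: the error is measured against the common size B. In this form the
  telescoping of a monomial becomes closure under products.\<close>

definition close :: "real \<Rightarrow> real \<Rightarrow> ('k \<Rightarrow> 'k) \<Rightarrow> ('k \<Rightarrow> 'k) \<Rightarrow> real \<Rightarrow> bool" where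
  "close r \<delta> u v B \<longleftrightarrow> meromorphic absv u \<and> meromorphic absv v \<and> mu_merom absv r u \<le> B \<and>
     mu_merom absv r v \<le> B \<and> mu_merom absv r (\<lambda>z. u z - v z) \<le> \<delta> * B"

lemma close_1: "0 < r \<Longrightarrow> 0 \<le> \<delta> \<Longrightarrow> close r \<delta> (\<lambda>_. 1) (\<lambda>_. 1) 1"
  by (simp add: close_def mu_merom_const)

lemma close_mult:
  assumes "close r \<delta> u v B" "close r \<delta> u' v' B'" "0 < r" "0 \<le> \<delta>"
  shows "close r \<delta> (\<lambda>z. u z * u' z) (\<lambda>z. v z * v' z) (B * B')"
proof -
  have m: "meromorphic absv u" "meromorphic absv v" "meromorphic absv u'" "meromorphic absv v'"
    "meromorphic absv (\<lambda>z. u z - v z)" "meromorphic absv (\<lambda>z. u' z - v' z)"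
    using assms by (auto simp: close_def intro!: meromorphic_diff)
  have le: "mu_merom absv r u \<le> B" "mu_merom absv r u' \<le> B'" "mu_merom absv r v \<le> B"
    "mu_merom absv r v' \<le> B'" "mu_merom absv r (\<lambda>z. u z - v z) \<le> \<delta> * B"
    "mu_merom absv r (\<lambda>z. u' z - v' z) \<le> \<delta> * B'"
    using assms by (auto simp: close_def)
  have nn: "0 \<le> mu_merom absv r w" if "meromorphic absv w" for w
    using that assms(3) by (rule mu_merom_nonneg)
  have B: "0 \<le> B" "0 \<le> B'"
    using nn[OF m(1)] nn[OF m(3)] le by linarith+
  have 1: "mu_merom absv r u * mu_merom absv r (\<lambda>z. u' z - v' z) \<le> B * (\<delta> * B')"
    using le m B nn by (intro mult_mono) auto
  have 2: "mu_merom absv r (\<lambda>z. u z - v z) * mu_merom absv r v' \<le> \<delta> * B * B'"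
    using le m B nn assms(4) by (intro mult_mono) auto
  \<comment> \<open>The ultrametric inequality takes the maximum of the two telescoping terms, so no
    factor 2 builds up and the error stays \<delta> relative to B B'.\<close>
  have "(\<lambda>z. u z * u' z - v z * v' z) = (\<lambda>z. u z * (u' z - v' z) + (u z - v z) * v' z)"
    by (simp add: algebra_simps)
  then have "mu_merom absv r (\<lambda>z. u z * u' z - v z * v' z) \<le>
     max (mu_merom absv r (\<lambda>z. u z * (u' z - v' z))) (mu_merom absv r (\<lambda>z. (u z - v z) * v' z))"
    using m assms(3) by (simp only:) (intro mu_merom_add_le meromorphic_mult)
  also have "\<dots> \<le> \<delta> * (B * B')"
    using 1 2 m assms(3) by (simp add: mu_merom_mult mult_ac)
  finally show ?thesis
    unfolding close_def using m assms(3) le B nn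
    by (auto simp: mu_merom_mult intro!: meromorphic_mult mult_mono)
qed

lemma close_power:
  assumes "close r \<delta> u v B" "0 < r" "0 \<le> \<delta>"
  shows "close r \<delta> (\<lambda>z. u z ^ k) (\<lambda>z. v z ^ k) (B ^ k)"
proof (induction k)
  case (Suc k)
  then show ?case using close_mult[OF assms(1) Suc assms(2,3)] by simp
qed (use close_1 assms in simp)

lemma close_prod:
  assumes "finite A" "\<And>i. i \<in> A \<Longrightarrow> close r \<delta> (u i) (v i) (B i)" "0 < r" "0 \<le> \<delta>"
  shows "close r \<delta> (\<lambda>z. \<Prod>i\<in>A. u i z) (\<lambda>z. \<Prod>i\<in>A. v i z) (\<Prod>i\<in>A. B i)"
  using assms(1,2)
proof (induction A rule: finite_induct)
  case (insert i A)
  then show ?case using close_mult[of r \<delta> "u i" "v i" "B i"] assms(3,4) by simp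
qed (use close_1 assms in simp)

lemma mu_merom_sum_le:
  assumes "finite A" "\<And>i. i \<in> A \<Longrightarrow> meromorphic absv (f i)"
    "\<And>i. i \<in> A \<Longrightarrow> mu_merom absv r (f i) \<le> B" "0 < r" "0 \<le> B"
  shows "meromorphic absv (\<lambda>z. \<Sum>i\<in>A. f i z) \<and> mu_merom absv r (\<lambda>z. \<Sum>i\<in>A. f i z) \<le> B"
  using assms(1-3)
proof (induction A rule: finite_induct)
  case empty
  then show ?case using assms by (simp add: mu_merom_const)
next
  case (insert i A)
  then show ?case
    using mu_merom_add_le[of "f i" "\<lambda>z. \<Sum>i\<in>A. f i z" r] assms(4)
    by (auto intro!: meromorphic_add intro: order_trans)
qed

end

section \<open>The proximity function of the reciprocal difference\<close>

lemma prod_exp_power: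
  fixes x :: real
  shows "(\<Prod>j\<in>A. exp x ^ i j) = exp (real (sum i A) * x)"
  by (simp add: power_sum exp_of_nat_mult del: of_nat_sum)

lemma (in nonarch_field) prox_m_inverse_diff_le:
  assumes \<alpha>: "\<And>j. j \<le> n \<Longrightarrow> absv (\<alpha> j) = 1"
    and s: "1 \<le> s" "\<And>j. j \<le> n \<Longrightarrow> absv (\<beta> j) \<le> s" "s \<le> r"
    and I: "finite I" and c: "\<And>i. i \<in> I \<Longrightarrow> meromorphic absv (c i)"
    and f: "meromorphic absv f" and a: "meromorphic absv a"
    and zero: "ae_eq absv (Omega_eval c I n (\<lambda>j z. f (\<alpha> j * z + \<beta> j))) (\<lambda>_. 0)"
    and nonzero: "\<not> ae_eq absv (Omega_eval c I n (\<lambda>j z. a (\<alpha> j * z + \<beta> j))) (\<lambda>_. 0)"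
  shows "prox_m absv r (\<lambda>z. inverse (f z - a z)) \<le>
    (\<Sum>i\<in>I. char_T absv r (c i)) + real (\<Sum>i\<in>I. \<Sum>j\<le>n. i j) * char_T absv r a +
    \<bar>ln (mu_merom absv s (Omega_eval c I n (\<lambda>j z. a (\<alpha> j * z + \<beta> j))))\<bar>"
proof -
  define aj where "aj = (\<lambda>j z. a (\<alpha> j * z + \<beta> j))"
  define fj where "fj = (\<lambda>j z. f (\<alpha> j * z + \<beta> j))"
  define F where "F = Omega_eval c I n aj"
  \<comment> \<open>Total degrees are summed over all monomials because adding fractions multiplies
    their denominators. The Gauss norm estimate is coarsened to the same D so that m and N combine
    to T.\<close>
  define D where "D = (\<Sum>i\<in>I. \<Sum>j\<le>n. i j)"
  define \<delta> where "\<delta> = mu_merom absv r (\<lambda>z. f z - a z)"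
  have r: "0 < r" "1 \<le> r" "0 < s" using s by auto
  note m = prox_m_nonneg and N = count_N_nonneg[OF _ r(2)]
  have T_nonneg: "0 \<le> char_T absv r g" if "meromorphic absv g" for g
    using m N[OF that] by (simp add: char_T_def)
  have h: "meromorphic absv (\<lambda>z. f z - a z)"
    using f a by (rule meromorphic_diff)
  \<comment> \<open>If f = a off a thin set, the same holds after each affine map, and \<Omega>(a,
    ...) would vanish along with \<Omega>(f, ...).\<close>
  have h0: "\<not> ae_eq absv (\<lambda>z. f z - a z) (\<lambda>_. 0)"
  proof
    assume "ae_eq absv (\<lambda>z. f z - a z) (\<lambda>_. 0)"
    then have *: "\<forall>\<^sub>F z in cothin. f z = a z"
      by (simp add: ae_eq_iff)
    have "\<forall>\<^sub>F z in cothin. \<forall>j\<in>{..n}. fj j z = aj j z"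
      using eventually_cothin_affine[OF * \<alpha>] by (intro eventually_ball_finite) (auto simp: fj_def aj_def)
    then have "\<forall>\<^sub>F z in cothin. F z = 0"
      using zero[unfolded ae_eq_iff] unfolding fj_def[symmetric]
      by eventually_elim (simp add: F_def Omega_eval_def)
    then show False
      using nonzero by (simp add: F_def aj_def ae_eq_iff)
  qed
  have \<delta>: "\<delta> > 0"
    unfolding \<delta>_def using h h0 r by (intro mu_merom_pos)
  have prox: "prox_m absv r (\<lambda>z. inverse (f z - a z)) = max 0 (- ln \<delta>)"
    unfolding prox_m_def \<delta>_def using mu_merom_inverse[OF h r(1) h0] \<delta>
    by (simp add: ln_inverse \<delta>_def)
  have rhs: "0 \<le> (\<Sum>i\<in>I. char_T absv r (c i)) + real D * char_T absv r a + \<bar>ln (mu_merom absv s F)\<bar>"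
    using T_nonneg a c by (auto intro!: add_nonneg_nonneg sum_nonneg)
  have "- ln \<delta> \<le> (\<Sum>i\<in>I. char_T absv r (c i)) + real D * char_T absv r a + \<bar>ln (mu_merom absv s F)\<bar>"
  proof (cases "\<delta> < 1")
    case False
    then have "- ln \<delta> \<le> 0" by simp
    then show ?thesis using rhs by linarith
  next
    case True
    define A where "A = exp (prox_m absv r a)"
    have A: "max 1 (mu_merom absv r a) \<le> A"
      unfolding A_def using a r(1) by (rule mu_merom_le_exp_prox_m)
    have "mu_merom absv r (\<lambda>z. (f z - a z) + a z) \<le> max \<delta> (mu_merom absv r a)"
      unfolding \<delta>_def using h a r(1) by (rule mu_merom_add_le)
    then have "mu_merom absv r f \<le> max \<delta> (mu_merom absv r a)" by simp
    \<comment> \<open>This is where \<delta> < 1 enters: f = (f - a) + a is then bounded by the same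
      A as a, so no term in f survives.\<close>
    then have fA: "mu_merom absv r f \<le> A"
      using A True by linarith
    have close: "close r \<delta> (aj j) (fj j) A" if "j \<le> n" for j
    proof -
      have \<beta>: "absv (\<beta> j) \<le> r" using s(2)[OF that] s(3) by simp
      have "mu_merom absv r (\<lambda>z. aj j z - fj j z) = mu_merom absv r (\<lambda>z. - (fj j z - aj j z))"
        by simp
      also have "\<dots> = mu_merom absv r (\<lambda>z. fj j z - aj j z)"
        unfolding fj_def aj_def using \<alpha>[OF that] f a r(1)
        by (intro mu_merom_uminus meromorphic_diff meromorphic_affine)
      also have "\<dots> = \<delta>"
        unfolding fj_def aj_def \<delta>_def by (rule mu_merom_affine[OF h \<alpha>[OF that] \<beta> r(1)])
      also have "\<dots> \<le> \<delta> * A"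
        using A \<delta> by simp
      finally have "mu_merom absv r (\<lambda>z. aj j z - fj j z) \<le> \<delta> * A" .
      moreover have "mu_merom absv r (aj j) \<le> A" "mu_merom absv r (fj j) \<le> A"
        unfolding fj_def aj_def using A fA a f \<alpha>[OF that] \<beta> r(1) by (simp_all add: mu_merom_affine)
      ultimately show ?thesis
        unfolding close_def using a f \<alpha>[OF that]
        by (auto simp: aj_def fj_def intro!: meromorphic_affine)
    qed
    \<comment> \<open>The summands of \<Omega>(a, ...) - \<Omega>(f, ...), each with one small
      factor.\<close>
    define P where "P = (\<lambda>i z. c i z * ((\<Prod>j\<le>n. aj j z ^ i j) - (\<Prod>j\<le>n. fj j z ^ i j)))"
    define E where "E = exp ((\<Sum>i\<in>I. prox_m absv r (c i)) + real D * prox_m absv r a)"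
    have P: "meromorphic absv (P i) \<and> mu_merom absv r (P i) \<le> \<delta> * E" if i: "i \<in> I" for i
    proof -
      have cl: "close r \<delta> (\<lambda>z. \<Prod>j\<le>n. aj j z ^ i j) (\<lambda>z. \<Prod>j\<le>n. fj j z ^ i j) (\<Prod>j\<le>n. A ^ i j)"
        using close r(1) \<delta> by (intro close_prod close_power) auto
      then have mer: "meromorphic absv (\<lambda>z. (\<Prod>j\<le>n. aj j z ^ i j) - (\<Prod>j\<le>n. fj j z ^ i j))"
        by (auto simp: close_def intro!: meromorphic_diff)
      have "mu_merom absv r (P i) = mu_merom absv r (c i) *
          mu_merom absv r (\<lambda>z. (\<Prod>j\<le>n. aj j z ^ i j) - (\<Prod>j\<le>n. fj j z ^ i j))"
        unfolding P_def using c[OF i] mer r(1) by (rule mu_merom_mult)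
      also have "\<dots> \<le> exp (prox_m absv r (c i)) * (\<delta> * (\<Prod>j\<le>n. A ^ i j))"
        using cl mu_merom_le_exp_prox_m[OF c[OF i] r(1)] mu_merom_nonneg[OF mer r(1)]
        by (intro mult_mono) (auto simp: close_def)
      also have "(\<Prod>j\<le>n. A ^ i j) = exp (real (\<Sum>j\<le>n. i j) * prox_m absv r a)"
        unfolding A_def by (rule prod_exp_power)
      also have "exp (prox_m absv r (c i)) * (\<delta> * exp (real (\<Sum>j\<le>n. i j) * prox_m absv r a)) =
          \<delta> * exp (prox_m absv r (c i) + real (\<Sum>j\<le>n. i j) * prox_m absv r a)"
        by (simp add: exp_add)
      also have "\<dots> \<le> \<delta> * E"
      proof -
        have "prox_m absv r (c i) \<le> (\<Sum>i\<in>I. prox_m absv r (c i))"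
          using I i m by (intro member_le_sum) auto
        moreover have "(\<Sum>j\<le>n. i j) \<le> D"
          unfolding D_def using I i by (intro member_le_sum) auto
        then have "real (\<Sum>j\<le>n. i j) * prox_m absv r a \<le> real D * prox_m absv r a"
          using m by (intro mult_right_mono) (simp_all del: of_nat_sum)
        ultimately show ?thesis
          unfolding E_def using \<delta> by (intro mult_left_mono) auto
      qed
      finally show ?thesis
        unfolding P_def using c[OF i] mer by (auto intro: meromorphic_mult)
    qed
    have sumP: "meromorphic absv (\<lambda>z. \<Sum>i\<in>I. P i z) \<and> mu_merom absv r (\<lambda>z. \<Sum>i\<in>I. P i z) \<le> \<delta> * E"
      using I P r(1) \<delta> by (intro mu_merom_sum_le) (auto simp: E_def)
    have "\<forall>\<^sub>F z in cothin. F z = (\<Sum>i\<in>I. P i z)"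
      using zero[unfolded ae_eq_iff] unfolding fj_def[symmetric]
      by eventually_elim
        (simp add: F_def P_def Omega_eval_def right_diff_distrib sum_subtractf)
    then have "mu_merom absv r F \<le> \<delta> * E"
      using mu_merom_cong[of "\<lambda>z. \<Sum>i\<in>I. P i z" r F] sumP r(1) by (simp add: ae_eq_iff)
    moreover have "mu_merom absv s F \<le>
        mu_merom absv r F * exp ((\<Sum>i\<in>I. count_N absv r (c i)) + real D * count_N absv r a)"
    proof -
      have "den_bound s r F (\<Prod>i\<in>I. exp (count_N absv r (c i)) * (\<Prod>j\<le>n. exp (count_N absv r a) ^ i j))"
        unfolding F_def Omega_eval_def
      proof (intro den_bound_sum[OF s(1,3)] den_bound_mult[OF s(1,3)] den_bound_prod[OF s(1,3)]
          den_bound_power[OF s(1,3)] I)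
        show "den_bound s r (c i) (exp (count_N absv r (c i)))" if "i \<in> I" for i
          \<comment> \<open>The coefficients are not shifted, so the identity map 1 z + 0 is
            used.\<close>
          using den_bound_exp_count_N[OF s(1,3) c[OF that], of 1 0] s(1) by simp
        show "den_bound s r (aj j) (exp (count_N absv r a))" if "j \<in> {..n}" for j
          unfolding aj_def using den_bound_exp_count_N[OF s(1,3) a \<alpha> s(2)] that by simp
      qed simp
      also have "(\<Prod>i\<in>I. exp (count_N absv r (c i)) * (\<Prod>j\<le>n. exp (count_N absv r a) ^ i j)) =
          exp ((\<Sum>i\<in>I. count_N absv r (c i)) + real D * count_N absv r a)"
        unfolding prod_exp_power exp_add[symmetric] exp_sum[OF I, symmetric]
        by (simp add: sum.distrib D_def sum_distrib_right)
      finally show ?thesis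
        by (rule mu_merom_ge[OF s(1,3)])
    qed
    ultimately have "mu_merom absv s F \<le> \<delta> * E *
        exp ((\<Sum>i\<in>I. count_N absv r (c i)) + real D * count_N absv r a)"
      by (meson exp_ge_zero mult_right_mono order_trans)
    also have "\<dots> = \<delta> * exp ((\<Sum>i\<in>I. char_T absv r (c i)) + real D * char_T absv r a)"
      by (simp add: E_def char_T_def sum.distrib distrib_left exp_add)
    finally have le: "mu_merom absv s F \<le> \<delta> * exp ((\<Sum>i\<in>I. char_T absv r (c i)) + real D * char_T absv r a)" .
    have "meromorphic absv F"
      using sumP \<open>\<forall>\<^sub>F z in cothin. F z = (\<Sum>i\<in>I. P i z)\<close> rep_cong unfolding meromorphic_iff by blast
    then have "0 < mu_merom absv s F"
      using nonzero r(3) by (intro mu_merom_pos) (auto simp: F_def aj_def)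
    with le have "ln (mu_merom absv s F) \<le> ln (\<delta> * exp ((\<Sum>i\<in>I. char_T absv r (c i)) + real D * char_T absv r a))"
      using \<delta> by (subst ln_le_cancel_iff) auto
    then show ?thesis
      using \<delta> by (simp add: ln_mult)
  qed
  then show ?thesis
    using rhs unfolding prox D_def F_def aj_def by (intro max.boundedI)
qed

theorem theorem1p6:
  fixes absv :: "'k::field_char_0 \<Rightarrow> real"
    and n :: nat and \<alpha> \<beta> :: "nat \<Rightarrow> 'k"
    and I :: "(nat \<Rightarrow> nat) set" and c :: "(nat \<Rightarrow> nat) \<Rightarrow> 'k \<Rightarrow> 'k"
    and f a :: "'k \<Rightarrow> 'k"
  assumes "nonarch_abs absv" and "nontrivial_abs absv" and "complete_abs absv"
    and "\<forall>p :: 'k poly. degree p > 0 \<longrightarrow> (\<exists>z. poly p z = 0)"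
    and "n > 0"
    and "\<forall>i\<le>n. absv (\<alpha> i) = 1" and "\<alpha> 0 = 1" and "\<beta> 0 = 0"
    and "\<forall>i\<le>n. \<forall>j\<le>n. i \<noteq> j \<longrightarrow> (\<lambda>z. \<alpha> i * z + \<beta> i) \<noteq> (\<lambda>z. \<alpha> j * z + \<beta> j)"
    and "finite I" and "\<forall>i\<in>I. \<forall>j>n. i j = 0"
    and "\<forall>i\<in>I. meromorphic absv (c i)"
    and "\<exists>i\<in>I. \<not> ae_eq absv (c i) (\<lambda>_. 0)"
    and "meromorphic absv f" and "\<not> (\<exists>C. ae_eq absv f (\<lambda>_. C))"
    and "ae_eq absv (Omega_eval c I n (\<lambda>j z. f (\<alpha> j * z + \<beta> j))) (\<lambda>_. 0)"
    and "(\<lambda>r. \<Sum>i\<in>I. char_T absv r (c i)) \<in> o[at_top](\<lambda>r. char_T absv r f)"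
    and "meromorphic absv a"
    and "(\<lambda>r. char_T absv r a) \<in> o[at_top](\<lambda>r. char_T absv r f)"
    and "\<not> ae_eq absv (Omega_eval c I n (\<lambda>j z. a (\<alpha> j * z + \<beta> j))) (\<lambda>_. 0)"
  shows "(\<lambda>r. prox_m absv r (\<lambda>z. inverse (f z - a z))) \<in> o[at_top](\<lambda>r. char_T absv r f)"
proof -
  interpret nonarch_field absv
    using assms(1-4) by unfold_locales blast+
  \<comment> \<open>A fixed radius, at least 1 and at least every |\<beta> j|, from which all affine
    maps preserve Gauss norms.\<close>
  define s where "s = 1 + (\<Sum>j\<le>n. absv (\<beta> j))"
  have s1: "1 \<le> s"
    by (simp add: s_def sum_nonneg)
  have s2: "absv (\<beta> j) \<le> s" if "j \<le> n" for j
    using member_le_sum[of j "{..n}" "\<lambda>j. absv (\<beta> j)"] that by (simp add: s_def)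
  define D where "D = real (\<Sum>i\<in>I. \<Sum>j\<le>n. i j)"
  define K where "K = \<bar>ln (mu_merom absv s (Omega_eval c I n (\<lambda>j z. a (\<alpha> j * z + \<beta> j))))\<bar>"
  obtain C where C: "\<And>r. C \<le> r \<Longrightarrow> ln r - C \<le> char_T absv r f"
    using char_T_ge_ln[OF assms(14,15)] by blast
  have T_lim: "filterlim (\<lambda>r. char_T absv r f) at_top at_top"
  proof (rule filterlim_at_top_mono)
    show "filterlim (\<lambda>r. - C + ln r) at_top at_top"
      by (rule filterlim_tendsto_add_at_top[OF tendsto_const ln_at_top])
    show "\<forall>\<^sub>F r in at_top. - C + ln r \<le> char_T absv r f"
      using eventually_ge_at_top[of C] by eventually_elim (use C in simp)
  qed
  \<comment> \<open>The constant left over at radius s is negligible since T(r, f) tends to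
    infinity.\<close>
  have K: "(\<lambda>_. K) \<in> o[at_top](\<lambda>r. char_T absv r f)"
  proof (rule landau_o.smallI)
    fix e :: real assume "e > 0"
    have "\<forall>\<^sub>F r in at_top. K / e \<le> char_T absv r f"
      using T_lim by (simp add: filterlim_at_top)
    then show "\<forall>\<^sub>F r in at_top. norm K \<le> e * norm (char_T absv r f)"
    proof eventually_elim
      case (elim r)
      then have "K \<le> e * char_T absv r f"
        using \<open>e > 0\<close> by (simp add: pos_divide_le_eq mult.commute)
      also have "\<dots> \<le> e * \<bar>char_T absv r f\<bar>"
        using \<open>e > 0\<close> by (intro mult_left_mono) auto
      finally show ?case by (simp add: K_def)
    qed
  qed
  have "(\<lambda>r. (\<Sum>i\<in>I. char_T absv r (c i)) + D * char_T absv r a + K) \<in> o[at_top](\<lambda>r. char_T absv r f)"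
    using assms(17,19) K by (intro sum_in_smallo) auto
  moreover have "(\<lambda>r. prox_m absv r (\<lambda>z. inverse (f z - a z))) \<in>
      O[at_top](\<lambda>r. (\<Sum>i\<in>I. char_T absv r (c i)) + D * char_T absv r a + K)"
  proof (rule landau_o.bigI[of 1])
    show "\<forall>\<^sub>F r in at_top. norm (prox_m absv r (\<lambda>z. inverse (f z - a z))) \<le>
        1 * norm ((\<Sum>i\<in>I. char_T absv r (c i)) + D * char_T absv r a + K)"
      using eventually_ge_at_top[of s]
    proof eventually_elim
      case (elim r)
      have "prox_m absv r (\<lambda>z. inverse (f z - a z)) \<le>
          (\<Sum>i\<in>I. char_T absv r (c i)) + D * char_T absv r a + K"
        unfolding D_def K_def using assms s1 s2 elim by (intro prox_m_inverse_diff_le) auto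
      then show ?case
        using prox_m_nonneg[of r "\<lambda>z. inverse (f z - a z)"] by simp
    qed
  qed simp
  ultimately show ?thesis
    by (rule landau_o.big_small_trans[rotated])
qed

end
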